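(* There is an absolute constant $C>0$ such that the following holds. Let $X\in\mathbb{R}^{n\times d}$ have $\ell_1$ Lewis weights $\{w_i\}_{i\in[n]}$, and let $0<\varepsilon,\delta<1$. Then for any integer $N\ge C\,\frac{d}{\varepsilon^2}\log\frac{d}{\varepsilon\delta}$ there is a sampling-and-reweighting distribution $\mathcal{S}(\{p_i\}_{i=1}^n)$ with $\sum_i p_i=N$ such that for every $y\in\mathbb{R}^n$: if $S\sim\mathcal{S}(\{p_i\}_{i=1}^n)$ and $\widehat\beta\in\arg\min_{\beta}\|SX\beta-Sy\|_1$, then with probability at least $1-\delta$, \[\|X\widehat\beta-y\|_1\le(1+\varepsilon)\min_{\beta\in\mathbb{R}^d}\|X\beta-y\|_1 .\] Moreover, if $\delta$ is a fixed constant, then $N\ge C'\frac{1}{\varepsilon^2}d\log d$ rows suffice, for a constant $C'$ depending only on $\delta$.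
   Context: Let $x_i^\top$ denote the $i$-th row of $X$; $X$ is assumed to have full column rank. The $\ell_1$ Lewis weights of $X$ are the unique positive numbers $w_1,\dots,w_n$ satisfying $w_i^2=x_i^\top\big(\sum_{j=1}^n \frac{1}{w_j}x_jx_j^\top\big)^{-1}x_i$ for all $i$. For nonnegative numbers $p_1,\dots,p_n$ with $N=\sum_i p_i$, the sampling-and-reweighting distribution $\mathcal{S}(\{p_i\}_{i=1}^n)$ is the distribution on matrices $S\in\mathbb{R}^{N\times n}$ whose rows are independent, each row being $\frac{1}{p_i}e_i^\top$ with probability $\frac{p_i}{N}$ (where $e_i$ is the $i$-th standard basis vector of $\mathbb{R}^n$).
   Formalization: The "moreover" part is stated for d ≥ 2 only: at d = 1 the bound d log d is 0, so it would claim that N = 0 rows suffice, which is false; the first part is stated for d ≥ 1. *)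

theory Defs
  imports "HOL-Probability.Probability"
begin

text \<open>Matrices are functions nat => nat => real; vectors nat => real.
  Only entries with indices inside the stated bounds are relevant.\<close>

definition matvec :: "nat \<Rightarrow> (nat \<Rightarrow> nat \<Rightarrow> real) \<Rightarrow> (nat \<Rightarrow> real) \<Rightarrow> nat \<Rightarrow> real" where
  "matvec m A v = (\<lambda>r. \<Sum>j<m. A r j * v j)"

definition matmul :: "nat \<Rightarrow> (nat \<Rightarrow> nat \<Rightarrow> real) \<Rightarrow> (nat \<Rightarrow> nat \<Rightarrow> real) \<Rightarrow> nat \<Rightarrow> nat \<Rightarrow> real" where
  "matmul m A B = (\<lambda>r c. \<Sum>i<m. A r i * B i c)"

definition l1norm :: "nat \<Rightarrow> (nat \<Rightarrow> real) \<Rightarrow> real" where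
  "l1norm m v = (\<Sum>r<m. \<bar>v r\<bar>)"

definition full_col_rank :: "nat \<Rightarrow> nat \<Rightarrow> (nat \<Rightarrow> nat \<Rightarrow> real) \<Rightarrow> bool" where
  "full_col_rank n d X \<longleftrightarrow> (\<forall>\<beta>. (\<forall>i<n. matvec d X \<beta> i = 0) \<longrightarrow> (\<forall>j<d. \<beta> j = 0))"

definition is_inverse :: "nat \<Rightarrow> (nat \<Rightarrow> nat \<Rightarrow> real) \<Rightarrow> (nat \<Rightarrow> nat \<Rightarrow> real) \<Rightarrow> bool" where
  "is_inverse d M B \<longleftrightarrow> (\<forall>j<d. \<forall>k<d.
      matmul d M B j k = (if j = k then 1 else 0) \<and> matmul d B M j k = (if j = k then 1 else 0))"

definition lewis_weights :: "nat \<Rightarrow> nat \<Rightarrow> (nat \<Rightarrow> nat \<Rightarrow> real) \<Rightarrow> (nat \<Rightarrow> real) \<Rightarrow> bool" where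
  "lewis_weights n d X w \<longleftrightarrow> (\<forall>i<n. w i > 0) \<and>
     (\<exists>B. is_inverse d (\<lambda>j k. \<Sum>i<n. X i j * X i k / w i) B \<and>
          (\<forall>i<n. (w i)\<^sup>2 = (\<Sum>j<d. \<Sum>k<d. X i j * B j k * X i k)))"

text \<open>The sampling-and-reweighting distribution S({p_i}) with N = sum p_i rows.
  A draw is encoded by the index map k : {..<N} -> {..<n} (row r of S picks index k r);
  the rows are independent, row r picks i with probability p_i / N.\<close>
definition row_pmf :: "nat \<Rightarrow> (nat \<Rightarrow> real) \<Rightarrow> nat \<Rightarrow> nat pmf" where
  "row_pmf n p N = embed_pmf (\<lambda>i. if i < n then p i / real N else 0)"

definition sampling_pmf :: "nat \<Rightarrow> (nat \<Rightarrow> real) \<Rightarrow> nat \<Rightarrow> (nat \<Rightarrow> nat) pmf" where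
  "sampling_pmf n p N = Pi_pmf {..<N} 0 (\<lambda>_. row_pmf n p N)"

definition sketch_matrix :: "(nat \<Rightarrow> real) \<Rightarrow> (nat \<Rightarrow> nat) \<Rightarrow> nat \<Rightarrow> nat \<Rightarrow> real" where
  "sketch_matrix p k = (\<lambda>r i. if i = k r then 1 / p i else 0)"

definition sketched_obj :: "nat \<Rightarrow> nat \<Rightarrow> nat \<Rightarrow> (nat \<Rightarrow> nat \<Rightarrow> real) \<Rightarrow> (nat \<Rightarrow> real)
    \<Rightarrow> (nat \<Rightarrow> real) \<Rightarrow> (nat \<Rightarrow> nat) \<Rightarrow> (nat \<Rightarrow> real) \<Rightarrow> real" where
  "sketched_obj n d N X y p k \<beta> =
     l1norm N (\<lambda>r. matvec d (matmul n (sketch_matrix p k) X) \<beta> r - matvec n (sketch_matrix p k) y r)"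

definition full_obj :: "nat \<Rightarrow> nat \<Rightarrow> (nat \<Rightarrow> nat \<Rightarrow> real) \<Rightarrow> (nat \<Rightarrow> real) \<Rightarrow> (nat \<Rightarrow> real) \<Rightarrow> real" where
  "full_obj n d X y \<beta> = l1norm n (\<lambda>i. matvec d X \<beta> i - y i)"

definition good_event :: "nat \<Rightarrow> nat \<Rightarrow> nat \<Rightarrow> (nat \<Rightarrow> nat \<Rightarrow> real) \<Rightarrow> (nat \<Rightarrow> real)
    \<Rightarrow> (nat \<Rightarrow> real) \<Rightarrow> real \<Rightarrow> (nat \<Rightarrow> nat) set" where
  "good_event n d N X y p \<epsilon> = {k. \<forall>\<beta>h. is_arg_min (sketched_obj n d N X y p k) (\<lambda>_. True) \<beta>h \<longrightarrow>
      full_obj n d X y \<beta>h \<le> (1 + \<epsilon>) * (INF \<beta>. full_obj n d X y \<beta>)}"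

end

theory Submission
  imports Defs
begin

text \<open>Sample row i with probability \<open>w i / d\<close>. If the sketched minimizer is bad, then by convexity
  some direction u with \<open>\<parallel>X u\<parallel>\<^sub>1 \<le> 1\<close> has an increase of the (centered, normalized) objective that the
  sample underestimates by \<open>\<epsilon> / 4\<close>. The exponential moment of the worst underestimate is bounded by
  symmetrization and Talagrand's contraction principle, which replaces the 1-Lipschitz functions
  \<open>s \<mapsto> \<bar>s - z\<bar> - \<bar>z\<bar>\<close> by the identity and leaves the supremum of a random linear functional.
  Expanding this functional in the kernel \<open>x\<^sub>i\<^sup>T B x\<^sub>j\<close> of the Lewis quadratic form and using
  \<open>\<bar>x\<^sub>i\<^sup>T u\<bar> \<le> w i\<close> on the unit ball, Jensen's inequality bounds its exponential by a sum with total weight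
  \<open>\<Sum>w i = d\<close> of moment generating functions of scalar sums. The failure probability is thus at most
  \<open>2 d exp (- \<epsilon>\<^sup>2 N / (256 d))\<close>, so \<open>N\<close> of order \<open>d / \<epsilon>\<^sup>2 * ln (d / \<delta>)\<close> suffices and both claims follow.
  The only case not covered is \<open>d = 1\<close> with \<open>\<epsilon>\<close>, \<open>\<delta>\<close> so close to 1 that the required \<open>N\<close> is below an
  absolute constant; there the minimizer is a weighted sample median, and it is good whenever all
  samples fall into a central set of mass at least 1/4.\<close>

subsection \<open>Symmetrization and contraction\<close>

text \<open>A maximum over a finite \<open>T\<close> is enough: the sampling distribution has finite
  support, and one bad direction is chosen for each bad sample.\<close>

definition exp_max :: "'b set \<Rightarrow> ('b \<Rightarrow> real) \<Rightarrow> real" where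
  "exp_max T h = exp (Max (h ` T))"

lemma exp_max_pos: "exp_max T h > 0"
  by (simp add: exp_max_def)

lemma exp_max_attained:
  assumes "finite T" "T \<noteq> {}"
  obtains b where "b \<in> T" "exp_max T h = exp (h b)"
proof -
  have "Max (h ` T) \<in> h ` T" using assms by simp
  then show ?thesis using that by (auto simp: exp_max_def)
qed

lemma exp_le_exp_max: "finite T \<Longrightarrow> b \<in> T \<Longrightarrow> exp (h b) \<le> exp_max T h"
  by (simp add: exp_max_def)

text \<open>The pair \<open>(a, b)\<close> is weakly majorized by \<open>(x, y)\<close>, and
  \<open>exp\<close> is convex and increasing. In the nontrivial case \<open>x < a \<le> y\<close>
  the claim comes from \<open>(exp y - exp a) * (exp a - exp x) \<ge> 0\<close>.\<close>

lemma exp_add_le_of_majorized: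
  fixes a b x y :: real
  assumes "a + b \<le> x + y" "a \<le> max x y" "b \<le> max x y"
  shows "exp a + exp b \<le> exp x + exp y"
proof -
  have *: "exp a + exp b \<le> exp x + exp y"
    if "a + b \<le> x + y" "a \<le> y" "b \<le> a" "x \<le> y" for a b x y :: real
  proof (cases "a \<le> x")
    case True
    then have "exp a \<le> exp x" "exp b \<le> exp y" using that by auto
    then show ?thesis by (rule add_mono)
  next
    case False
    have "exp b \<le> exp (x + y - a)" using that by simp
    also have "\<dots> = exp x * exp y / exp a" by (simp add: exp_add exp_diff)
    finally have b: "exp b \<le> exp x * exp y / exp a" .
    have "(exp y - exp a) * (exp a - exp x) \<ge> 0" using that False by simp
    then have "exp x * exp y \<le> (exp x + exp y - exp a) * exp a" by (simp add: algebra_simps)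
    then have "exp x * exp y / exp a \<le> exp x + exp y - exp a" by (simp add: divide_le_eq)
    with b show ?thesis by simp
  qed
  show ?thesis
    using *[of a b x y] *[of b a x y] *[of a b y x] *[of b a y x] assms
    by (cases "a \<le> b"; cases "x \<le> y") (auto simp: add.commute max_def)
qed

text \<open>The two-point case of Talagrand's contraction principle. If \<open>b\<close> and
  \<open>c\<close> attain the two maxima on the left, the Lipschitz bound controls the sum of the
  two exponents, since either of \<open>b\<close>, \<open>c\<close> may be used for either sign of
  \<open>t\<close>; the bound by \<open>\<bar>t b\<bar>\<close> controls each exponent separately,
  and majorization concludes.\<close>

lemma exp_max_contraction:
  assumes T: "finite T" "T \<noteq> {}"
    and lip: "\<And>b c. b \<in> T \<Longrightarrow> c \<in> T \<Longrightarrow> \<bar>\<psi> b - \<psi> c\<bar> \<le> \<bar>t b - t c\<bar>"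
    and le: "\<And>b. b \<in> T \<Longrightarrow> \<bar>\<psi> b\<bar> \<le> \<bar>t b\<bar>"
  shows "exp_max T (\<lambda>b. h b + \<psi> b) + exp_max T (\<lambda>b. h b - \<psi> b)
       \<le> exp_max T (\<lambda>b. h b + t b) + exp_max T (\<lambda>b. h b - t b)"
proof -
  define x where "x = Max ((\<lambda>b. h b + t b) ` T)"
  define y where "y = Max ((\<lambda>b. h b - t b) ` T)"
  have x: "h b + t b \<le> x" if "b \<in> T" for b using T that by (simp add: x_def)
  have y: "h b - t b \<le> y" if "b \<in> T" for b using T that by (simp add: y_def)
  obtain b where b: "b \<in> T" "exp_max T (\<lambda>b. h b + \<psi> b) = exp (h b + \<psi> b)"
    using exp_max_attained[OF T, of "\<lambda>b. h b + \<psi> b"] by auto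
  obtain c where c: "c \<in> T" "exp_max T (\<lambda>b. h b - \<psi> b) = exp (h c - \<psi> c)"
    using exp_max_attained[OF T, of "\<lambda>b. h b - \<psi> b"] by auto
  have "(h b + \<psi> b) + (h c - \<psi> c) \<le> x + y"
    using lip[OF b(1) c(1)] x[OF b(1)] y[OF b(1)] x[OF c(1)] y[OF c(1)] by linarith
  moreover have "h b + \<psi> b \<le> max x y"
    using le[OF b(1)] x[OF b(1)] y[OF b(1)] by linarith
  moreover have "h c - \<psi> c \<le> max x y"
    using le[OF c(1)] x[OF c(1)] y[OF c(1)] by linarith
  ultimately have "exp (h b + \<psi> b) + exp (h c - \<psi> c) \<le> exp x + exp y"
    by (rule exp_add_le_of_majorized)
  then show ?thesis using b c by (simp add: exp_max_def x_def y_def)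
qed

text \<open>Jensen's inequality with the missing mass \<open>1 - sum c I\<close> placed at 0; the
  proof averages the tangent line of \<open>exp\<close> at the mean \<open>m\<close>.\<close>

lemma exp_sum_le:
  fixes c a :: "'i \<Rightarrow> real"
  assumes c: "\<And>i. i \<in> I \<Longrightarrow> c i \<ge> 0" "sum c I \<le> 1"
  shows "exp (\<Sum>i\<in>I. c i * a i) \<le> 1 + (\<Sum>i\<in>I. c i * (exp (a i) - 1))"
proof -
  define m where "m = (\<Sum>i\<in>I. c i * a i)"
  have t: "exp m * (1 + s - m) \<le> exp s" for s
  proof -
    have "exp m * (1 + (s - m)) \<le> exp m * exp (s - m)"
      by (intro mult_left_mono exp_ge_add_one_self) auto
    then show ?thesis by (simp add: mult_exp_exp algebra_simps)
  qed
  have "exp m = (\<Sum>i\<in>I. c i * (exp m * (1 + a i - m))) + (1 - sum c I) * (exp m * (1 + 0 - m))"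
  proof -
    have "(\<Sum>i\<in>I. c i * (exp m * (1 + a i - m))) = exp m * (\<Sum>i\<in>I. c i * (1 - m) + c i * a i)"
      unfolding sum_distrib_left by (intro sum.cong) (auto simp: algebra_simps)
    also have "\<dots> = exp m * (sum c I * (1 - m) + m)"
      by (simp add: sum.distrib sum_distrib_right m_def)
    finally show ?thesis by (simp add: algebra_simps)
  qed
  also have "\<dots> \<le> (\<Sum>i\<in>I. c i * exp (a i)) + (1 - sum c I) * exp 0"
    using c t[of 0] t by (intro add_mono sum_mono mult_left_mono) auto
  finally show ?thesis by (simp add: m_def algebra_simps sum_subtractf)
qed

text \<open>Jensen's inequality pulls the average over an independent copy \<open>j\<close> of a
  sample out of the maximum, which starts the symmetrization.\<close>

lemma exp_max_centered_le:
  fixes \<psi> :: "'i \<Rightarrow> 'b \<Rightarrow> real"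
  assumes T: "finite T" "T \<noteq> {}"
    and q: "\<And>i. i \<in> I \<Longrightarrow> q i \<ge> 0" "sum q I = 1"
  shows "exp_max T (\<lambda>b. h b + (\<Sum>j\<in>I. q j * \<psi> j b)) \<le> (\<Sum>j\<in>I. q j * exp_max T (\<lambda>b. h b + \<psi> j b))"
proof -
  obtain b where b: "b \<in> T"
    "exp_max T (\<lambda>b. h b + (\<Sum>j\<in>I. q j * \<psi> j b)) = exp (h b + (\<Sum>j\<in>I. q j * \<psi> j b))"
    using exp_max_attained[OF T, of "\<lambda>b. h b + (\<Sum>j\<in>I. q j * \<psi> j b)"] by auto
  have "h b + (\<Sum>j\<in>I. q j * \<psi> j b) = (\<Sum>j\<in>I. q j * (h b + \<psi> j b))"
    by (simp add: algebra_simps sum.distrib q(2) flip: sum_distrib_left)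
  then have "exp (h b + (\<Sum>j\<in>I. q j * \<psi> j b)) \<le> 1 + (\<Sum>j\<in>I. q j * (exp (h b + \<psi> j b) - 1))"
    using exp_sum_le[of I q "\<lambda>j. h b + \<psi> j b"] q by simp
  also have "\<dots> = (\<Sum>j\<in>I. q j * exp (h b + \<psi> j b))"
    by (simp add: algebra_simps sum_subtractf q(2))
  also have "\<dots> \<le> (\<Sum>j\<in>I. q j * exp_max T (\<lambda>b. h b + \<psi> j b))"
    by (intro sum_mono mult_left_mono q exp_le_exp_max[OF T(1) b(1), of "\<lambda>b. h b + \<psi> _ b"])
  finally show ?thesis using b by simp
qed

text \<open>Convexity of \<open>exp\<close> decouples a sample from its copy, at the price of
  doubling both terms.\<close>

lemma exp_max_add_le:
  assumes T: "finite T" "T \<noteq> {}"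
  shows "exp_max T (\<lambda>b. h b + (f b + g b)) \<le> (exp_max T (\<lambda>b. h b + 2 * f b) + exp_max T (\<lambda>b. h b + 2 * g b)) / 2"
proof -
  obtain b where b: "b \<in> T" "exp_max T (\<lambda>b. h b + (f b + g b)) = exp (h b + (f b + g b))"
    using exp_max_attained[OF T, of "\<lambda>b. h b + (f b + g b)"] by auto
  have "exp (h b + (f b + g b)) + exp (h b + (f b + g b)) \<le> exp (h b + 2 * f b) + exp (h b + 2 * g b)"
    by (rule exp_add_le_of_majorized) (auto simp: max_def)
  then show ?thesis
    using b exp_le_exp_max[OF T(1) b(1), of "\<lambda>b. h b + 2 * f b"]
      exp_le_exp_max[OF T(1) b(1), of "\<lambda>b. h b + 2 * g b"] by simp
qed

text \<open>Symmetrization and contraction are performed one sample at a time, so no Rademacher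
  variables are needed as an explicit probability space.\<close>

lemma exp_max_symmetrization:
  fixes \<psi> t :: "nat \<Rightarrow> 'b \<Rightarrow> real"
  assumes T: "finite T" "T \<noteq> {}"
    and q: "\<And>i. i < n \<Longrightarrow> q i \<ge> 0" "(\<Sum>i<n. q i) = 1"
    and lip: "\<And>i b c. i < n \<Longrightarrow> b \<in> T \<Longrightarrow> c \<in> T \<Longrightarrow> \<bar>\<psi> i b - \<psi> i c\<bar> \<le> \<bar>t i b - t i c\<bar>"
    and le: "\<And>i b. i < n \<Longrightarrow> b \<in> T \<Longrightarrow> \<bar>\<psi> i b\<bar> \<le> \<bar>t i b\<bar>"
  shows "(\<Sum>i<n. q i * exp_max T (\<lambda>b. h b + ((\<Sum>j<n. q j * \<psi> j b) - \<psi> i b)))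
       \<le> (\<Sum>i<n. q i * ((exp_max T (\<lambda>b. h b + 2 * t i b) + exp_max T (\<lambda>b. h b - 2 * t i b)) / 2))"
    (is "?L \<le> ?R")
proof -
  define P where "P i = exp_max T (\<lambda>b. h b + 2 * \<psi> i b)" for i
  define M where "M i = exp_max T (\<lambda>b. h b - 2 * \<psi> i b)" for i
  have "?L \<le> (\<Sum>i<n. q i * (\<Sum>j<n. q j * exp_max T (\<lambda>b. h b + (\<psi> j b - \<psi> i b))))"
  proof (intro sum_mono mult_left_mono)
    fix i assume "i \<in> {..<n}"
    show "exp_max T (\<lambda>b. h b + ((\<Sum>j<n. q j * \<psi> j b) - \<psi> i b))
        \<le> (\<Sum>j<n. q j * exp_max T (\<lambda>b. h b + (\<psi> j b - \<psi> i b)))"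
      using exp_max_centered_le[OF T, of "{..<n}" q "\<lambda>b. h b - \<psi> i b" \<psi>] q
      by (simp add: algebra_simps)
  qed (use q in auto)
  \<comment> \<open>After decoupling, sample and copy have the same law \<open>q\<close>, so the
    double average collapses to one over \<open>2 * \<psi> i\<close> and
    \<open>- 2 * \<psi> i\<close> with weight 1/2 each. This is where the random sign
    appears.\<close>
  also have "\<dots> \<le> (\<Sum>i<n. q i * (\<Sum>j<n. q j * ((P j + M i) / 2)))"
    unfolding P_def M_def
    using exp_max_add_le[OF T, of h "\<psi> _" "\<lambda>b. - \<psi> _ b"] q
    by (intro sum_mono mult_left_mono) (auto simp: algebra_simps)
  also have "\<dots> = (\<Sum>i<n. \<Sum>j<n. q i * (q j * (P j / 2))) + (\<Sum>i<n. \<Sum>j<n. q j * (q i * (M i / 2)))"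
    by (simp add: sum_distrib_left algebra_simps add_divide_distrib flip: sum.distrib)
  also have "(\<Sum>i<n. \<Sum>j<n. q i * (q j * (P j / 2))) = (\<Sum>i<n. q i * (P i / 2))"
    using q(2) by (subst sum_product[symmetric]) simp
  also have "(\<Sum>i<n. \<Sum>j<n. q j * (q i * (M i / 2))) = (\<Sum>i<n. q i * (M i / 2))"
    using q(2) by (subst sum.swap, subst sum_product[symmetric]) simp
  also have "(\<Sum>i<n. q i * (P i / 2)) + (\<Sum>i<n. q i * (M i / 2)) = (\<Sum>i<n. q i * ((P i + M i) / 2))"
    by (simp add: algebra_simps add_divide_distrib flip: sum.distrib)
  also have "\<dots> \<le> ?R"
  proof (intro sum_mono mult_left_mono)
    fix i assume i: "i \<in> {..<n}"
    have "P i + M i \<le> exp_max T (\<lambda>b. h b + 2 * t i b) + exp_max T (\<lambda>b. h b - 2 * t i b)"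
      unfolding P_def M_def
    proof (rule exp_max_contraction[OF T])
      fix b c assume "b \<in> T" "c \<in> T"
      then show "\<bar>2 * \<psi> i b - 2 * \<psi> i c\<bar> \<le> \<bar>2 * t i b - 2 * t i c\<bar>"
        using lip[of i b c] i by (simp add: abs_if split: if_splits)
    next
      fix b assume "b \<in> T"
      then show "\<bar>2 * \<psi> i b\<bar> \<le> \<bar>2 * t i b\<bar>" using le[of i b] i by simp
    qed
    then show "(P i + M i) / 2 \<le> (exp_max T (\<lambda>b. h b + 2 * t i b) + exp_max T (\<lambda>b. h b - 2 * t i b)) / 2"
      by simp
  qed (use q in auto)
  finally show ?thesis .
qed


text \<open>\<open>walk T n q \<xi> r h\<close> is the expectation of the exponential of the maximum over T of h plus r
  independent increments \<open>\<xi> i\<close>, i drawn with probability \<open>q i\<close>; \<open>signed_walk\<close> is the same with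
  increments \<open>\<plusminus>2 t i\<close> carrying uniform independent signs.\<close>

primrec walk :: "'b set \<Rightarrow> nat \<Rightarrow> (nat \<Rightarrow> real) \<Rightarrow> (nat \<Rightarrow> 'b \<Rightarrow> real) \<Rightarrow> nat \<Rightarrow> ('b \<Rightarrow> real) \<Rightarrow> real" where
  "walk T n q \<xi> 0 h = exp_max T h"
| "walk T n q \<xi> (Suc r) h = (\<Sum>i<n. q i * walk T n q \<xi> r (\<lambda>b. h b + \<xi> i b))"

primrec signed_walk :: "'b set \<Rightarrow> nat \<Rightarrow> (nat \<Rightarrow> real) \<Rightarrow> (nat \<Rightarrow> 'b \<Rightarrow> real) \<Rightarrow> nat \<Rightarrow> ('b \<Rightarrow> real) \<Rightarrow> real" where
  "signed_walk T n q t 0 h = exp_max T h"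
| "signed_walk T n q t (Suc r) h = (\<Sum>i<n. q i *
     ((signed_walk T n q t r (\<lambda>b. h b + 2 * t i b) + signed_walk T n q t r (\<lambda>b. h b - 2 * t i b)) / 2))"

text \<open>Increments are replaced one at a time. The induction hypothesis signs all but the first;
  \<open>exchange\<close> then commutes the remaining one past the signed increments until it stands
  next to the maximum, where \<open>exp_max_symmetrization\<close> applies with the others absorbed
  into \<open>h\<close>.\<close>

lemma walk_le_signed_walk:
  fixes \<psi> t :: "nat \<Rightarrow> 'b \<Rightarrow> real"
  assumes T: "finite T" "T \<noteq> {}"
    and q: "\<And>i. i < n \<Longrightarrow> q i \<ge> 0" "(\<Sum>i<n. q i) = 1"
    and lip: "\<And>i b c. i < n \<Longrightarrow> b \<in> T \<Longrightarrow> c \<in> T \<Longrightarrow> \<bar>\<psi> i b - \<psi> i c\<bar> \<le> \<bar>t i b - t i c\<bar>"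
    and le: "\<And>i b. i < n \<Longrightarrow> b \<in> T \<Longrightarrow> \<bar>\<psi> i b\<bar> \<le> \<bar>t i b\<bar>"
    and \<xi>: "\<And>i b. \<xi> i b = (\<Sum>j<n. q j * \<psi> j b) - \<psi> i b"
  shows "walk T n q \<xi> r h \<le> signed_walk T n q t r h"
proof (induction r arbitrary: h)
  case (Suc r)
  have exchange: "(\<Sum>i<n. q i * signed_walk T n q t r (\<lambda>b. h b + \<xi> i b)) \<le> signed_walk T n q t (Suc r) h"
    for r h
  proof (induction r arbitrary: h)
    case 0
    show ?case using exp_max_symmetrization[OF T q lip le, where h = h] by (simp add: \<xi>)
  next
    case (Suc r)
    define S where "S i h = q i * signed_walk T n q t r h" for i h
    have "(\<Sum>i<n. q i * signed_walk T n q t (Suc r) (\<lambda>b. h b + \<xi> i b))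
      = (\<Sum>i<n. \<Sum>j<n. q j * ((S i (\<lambda>b. h b + \<xi> i b + 2 * t j b) + S i (\<lambda>b. h b + \<xi> i b - 2 * t j b)) / 2))"
      by (simp add: sum_distrib_left algebra_simps S_def add_divide_distrib)
    also have "\<dots> = (\<Sum>j<n. q j * (((\<Sum>i<n. S i (\<lambda>b. h b + 2 * t j b + \<xi> i b))
        + (\<Sum>i<n. S i (\<lambda>b. h b - 2 * t j b + \<xi> i b))) / 2))"
      by (subst sum.swap) (simp add: sum_distrib_left sum_divide_distrib add.commute add.left_commute
          diff_conv_add_uminus add_divide_distrib sum.distrib algebra_simps del: add_uminus_conv_diff)
    also have "\<dots> \<le> signed_walk T n q t (Suc (Suc r)) h"
      unfolding signed_walk.simps(2)[of T n q t "Suc r" h] S_def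
      by (intro sum_mono mult_left_mono divide_right_mono add_mono Suc.IH) (use q in auto)
    finally show ?case .
  qed
  have "walk T n q \<xi> (Suc r) h \<le> (\<Sum>i<n. q i * signed_walk T n q t r (\<lambda>b. h b + \<xi> i b))"
    using q by (auto intro!: sum_mono mult_left_mono Suc.IH)
  then show ?case using exchange[of r h] by linarith
qed simp

text \<open>Connects the recursion with the product distribution: conditioning on the last
  coordinate of the sample moves one increment into \<open>h\<close>.\<close>

lemma expectation_exp_max_sum:
  fixes \<xi> :: "nat \<Rightarrow> 'b \<Rightarrow> real"
  assumes "set_pmf q \<subseteq> {..<n}"
  shows "measure_pmf.expectation (Pi_pmf {..<N} dflt (\<lambda>_. q)) (\<lambda>k. exp_max T (\<lambda>b. h b + (\<Sum>r<N. \<xi> (k r) b)))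
       = walk T n (pmf q) \<xi> N h"
proof (induction N arbitrary: h)
  case 0
  show ?case by simp
next
  case (Suc N)
  have fin: "finite (set_pmf (Pi_pmf {..<N} dflt (\<lambda>_. q)))"
    using assms finite_subset
    by (subst set_Pi_pmf) (auto intro!: finite_PiE_dflt)
  have "Pi_pmf {..<Suc N} dflt (\<lambda>_. q)
      = q \<bind> (\<lambda>i. map_pmf (\<lambda>k. k(N := i)) (Pi_pmf {..<N} dflt (\<lambda>_. q)))"
    by (simp add: lessThan_Suc Pi_pmf_insert' map_pmf_def)
  then have "measure_pmf.expectation (Pi_pmf {..<Suc N} dflt (\<lambda>_. q))
        (\<lambda>k. exp_max T (\<lambda>b. h b + (\<Sum>r<Suc N. \<xi> (k r) b)))
     = (\<Sum>i<n. pmf q i * measure_pmf.expectation (Pi_pmf {..<N} dflt (\<lambda>_. q))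
        (\<lambda>k. exp_max T (\<lambda>b. h b + (\<Sum>r<Suc N. \<xi> ((k(N := i)) r) b))))"
    using assms fin by (simp add: pmf_expectation_bind[where A = "{..<n}"])
  also have "\<dots> = (\<Sum>i<n. pmf q i * measure_pmf.expectation (Pi_pmf {..<N} dflt (\<lambda>_. q))
        (\<lambda>k. exp_max T (\<lambda>b. (h b + \<xi> i b) + (\<Sum>r<N. \<xi> (k r) b))))"
    by (simp add: algebra_simps)
  also have "\<dots> = walk T n (pmf q) \<xi> (Suc N) h"
    using Suc.IH by simp
  finally show ?case .
qed

subsection \<open>The Lewis quadratic form\<close>

text \<open>Naming the inverse \<open>B\<close> of the weighted Gram matrix as a parameter gives
  access to the witness that is hidden in \<open>lewis_weights\<close>.\<close>

locale lewis_design =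
  fixes n d :: nat and X :: "nat \<Rightarrow> nat \<Rightarrow> real" and w :: "nat \<Rightarrow> real" and B :: "nat \<Rightarrow> nat \<Rightarrow> real"
  assumes w_pos: "i < n \<Longrightarrow> w i > 0"
    and inverse: "is_inverse d (\<lambda>j k. \<Sum>i<n. X i j * X i k / w i) B"
    and w_square: "i < n \<Longrightarrow> (w i)\<^sup>2 = (\<Sum>j<d. \<Sum>k<d. X i j * B j k * X i k)"
begin

text \<open>For \<open>v\<close> a row of \<open>X\<close> this is the reproducing kernel of the
  column space of \<open>X\<close> under the inner product with weights
  \<open>1 / w m\<close>.\<close>

definition score :: "(nat \<Rightarrow> real) \<Rightarrow> nat \<Rightarrow> real" where
  "score v i = (\<Sum>j<d. \<Sum>k<d. v j * B j k * X i k)"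

lemma score_add: "score (\<lambda>j. u j + v j) i = score u i + score v i"
  by (simp add: score_def algebra_simps sum.distrib)

lemma score_scale: "score (\<lambda>j. c * v j) i = c * score v i"
  by (simp add: score_def algebra_simps sum_distrib_left)

text \<open>The identity matrix is inserted between \<open>v\<close> and \<open>u\<close>, written
  as \<open>B\<close> times the weighted Gram matrix.\<close>

lemma inner_eq_sum_score:
  "(\<Sum>j<d. v j * u j) = (\<Sum>i<n. score v i * matvec d X u i / w i)"
proof -
  have delta: "(\<Sum>k<d. B j k * (\<Sum>i<n. X i k * X i l / w i)) = (if j = l then 1 else 0)"
    if "j < d" "l < d" for j l
    using inverse that by (simp add: is_inverse_def matmul_def)
  have "(\<Sum>i<n. score v i * matvec d X u i / w i)
      = (\<Sum>i<n. \<Sum>j<d. \<Sum>k<d. \<Sum>l<d. v j * u l * (B j k * (X i k * X i l / w i)))"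
    by (simp add: score_def matvec_def sum_distrib_left sum_distrib_right sum_divide_distrib mult.assoc
        mult.left_commute mult.commute)
  also have "\<dots> = (\<Sum>j<d. \<Sum>k<d. \<Sum>l<d. \<Sum>i<n. v j * u l * (B j k * (X i k * X i l / w i)))"
    by (simp add: sum.swap[of _ _ "{..<n}"])
  also have "\<dots> = (\<Sum>j<d. \<Sum>l<d. \<Sum>k<d. v j * u l * (B j k * (\<Sum>i<n. X i k * X i l / w i)))"
    unfolding sum_distrib_left by (rule sum.cong[OF refl], rule sum.swap)
  also have "\<dots> = (\<Sum>j<d. \<Sum>l<d. v j * u l * (if j = l then 1 else 0))"
    by (intro sum.cong refl) (simp add: delta flip: sum_distrib_left)
  also have "\<dots> = (\<Sum>j<d. v j * u j)"
    by (simp add: if_distrib cong: if_cong)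
  finally show ?thesis by simp
qed

lemma matvec_eq_sum_score: "matvec d X u i = (\<Sum>m<n. score (X i) m * matvec d X u m / w m)"
  using inner_eq_sum_score[of "X i" u] by (simp add: matvec_def)

lemma score_row_self: "i < n \<Longrightarrow> score (X i) i = (w i)\<^sup>2"
  by (simp add: score_def w_square)

text \<open>Each row of the kernel is itself of the form \<open>matvec d X u\<close>, so the
  reproducing identity applies to it. Symmetry of the kernel is then read off from the right-hand
  side.\<close>

lemma score_row_eq: "score (X i) j = (\<Sum>m<n. score (X i) m * score (X j) m / w m)"
proof -
  have *: "matvec d X (\<lambda>l. \<Sum>k<d. X j k * B k l) m = score (X j) m" for m
    unfolding matvec_def score_def sum_distrib_left
    by (subst sum.swap) (simp add: mult.commute mult.left_commute)
  have "score (X j) i = (\<Sum>m<n. score (X i) m * score (X j) m / w m)"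
    using matvec_eq_sum_score[of "\<lambda>l. \<Sum>k<d. X j k * B k l" i] by (simp add: *)
  moreover have **: "matvec d X (\<lambda>l. \<Sum>k<d. X i k * B k l) m = score (X i) m" for m
    unfolding matvec_def score_def sum_distrib_left
    by (subst sum.swap) (simp add: mult.commute mult.left_commute)
  have "score (X i) j = (\<Sum>m<n. score (X j) m * score (X i) m / w m)"
    using matvec_eq_sum_score[of "\<lambda>l. \<Sum>k<d. X i k * B k l" j] by (simp add: **)
  ultimately show ?thesis by (simp add: mult.commute)
qed

lemma score_row_commute: "score (X i) j = score (X j) i"
  by (subst score_row_eq, subst (2) score_row_eq) (simp add: mult.commute)

lemma sum_score_row_square: "i < n \<Longrightarrow> (\<Sum>m<n. (score (X i) m)\<^sup>2 / w m) = (w i)\<^sup>2"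
  using score_row_eq[of i i] score_row_self[of i] by (simp add: power2_eq_square)

lemma cauchy_schwarz_weighted:
  "\<bar>\<Sum>m<n. a m * b m / w m\<bar> \<le> sqrt (\<Sum>m<n. (a m)\<^sup>2 / w m) * sqrt (\<Sum>m<n. (b m)\<^sup>2 / w m)"
proof -
  have "(\<Sum>m<n. (a m / sqrt (w m)) * (b m / sqrt (w m)))\<^sup>2
      \<le> (\<Sum>m<n. (a m / sqrt (w m))\<^sup>2) * (\<Sum>m<n. (b m / sqrt (w m))\<^sup>2)"
    by (rule Cauchy_Schwarz_ineq_sum)
  also have "(\<Sum>m<n. (a m / sqrt (w m)) * (b m / sqrt (w m))) = (\<Sum>m<n. a m * b m / w m)"
    using w_pos by (intro sum.cong) (auto simp: less_imp_le)
  also have "(\<Sum>m<n. (a m / sqrt (w m))\<^sup>2) = (\<Sum>m<n. (a m)\<^sup>2 / w m)"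
    using w_pos by (intro sum.cong) (auto simp: less_imp_le power_divide)
  also have "(\<Sum>m<n. (b m / sqrt (w m))\<^sup>2) = (\<Sum>m<n. (b m)\<^sup>2 / w m)"
    using w_pos by (intro sum.cong) (auto simp: less_imp_le power_divide)
  finally have "sqrt ((\<Sum>m<n. a m * b m / w m)\<^sup>2) \<le> sqrt ((\<Sum>m<n. (a m)\<^sup>2 / w m) * (\<Sum>m<n. (b m)\<^sup>2 / w m))"
    by (rule real_sqrt_le_mono)
  then show ?thesis by (simp add: real_sqrt_mult)
qed

text \<open>Cauchy-Schwarz for the kernel, whose diagonal entries are \<open>(w i)\<^sup>2\<close>.
  It keeps the exponents of the moment generating functions bounded.\<close>

lemma abs_score_row_le:
  assumes "i < n" "j < n"
  shows "\<bar>score (X i) j\<bar> \<le> w i * w j"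
  using cauchy_schwarz_weighted[of "score (X i)" "score (X j)"] assms w_pos[of i] w_pos[of j]
  by (simp add: sum_score_row_square flip: score_row_eq)

text \<open>A self-bounding argument for the weighted Euclidean norm \<open>q\<close> of
  \<open>X u\<close>: Cauchy-Schwarz in the reproducing identity gives
  \<open>\<bar>matvec d X u m\<bar> \<le> w m * q\<close>, and inserting this into
  \<open>q\<^sup>2\<close> gives \<open>q\<^sup>2 \<le> q\<close> on the unit ball, hence
  \<open>q \<le> 1\<close>.\<close>

lemma abs_matvec_le:
  assumes u: "l1norm n (matvec d X u) \<le> 1" and i: "i < n"
  shows "\<bar>matvec d X u i\<bar> \<le> w i"
proof -
  define q where "q = sqrt (\<Sum>m<n. (matvec d X u m)\<^sup>2 / w m)"
  have sq: "q\<^sup>2 = (\<Sum>m<n. (matvec d X u m)\<^sup>2 / w m)"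
    unfolding q_def using w_pos by (intro real_sqrt_pow2 sum_nonneg) (auto simp: less_imp_le)
  have q0: "q \<ge> 0" unfolding q_def using w_pos by (intro real_sqrt_ge_zero sum_nonneg) (auto simp: less_imp_le)
  have le: "\<bar>matvec d X u m\<bar> \<le> w m * q" if "m < n" for m
    using cauchy_schwarz_weighted[of "score (X m)" "matvec d X u"] that w_pos[of m]
    by (simp add: sum_score_row_square q_def flip: matvec_eq_sum_score)
  have "q\<^sup>2 \<le> (\<Sum>m<n. \<bar>matvec d X u m\<bar> * q)"
    unfolding sq
  proof (rule sum_mono)
    fix m assume "m \<in> {..<n}"
    then have "\<bar>matvec d X u m\<bar> * \<bar>matvec d X u m\<bar> \<le> \<bar>matvec d X u m\<bar> * (w m * q)"
      using le by (intro mult_left_mono) auto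
    then show "(matvec d X u m)\<^sup>2 / w m \<le> \<bar>matvec d X u m\<bar> * q"
      using w_pos[of m] \<open>m \<in> {..<n}\<close> by (simp add: divide_le_eq power2_eq_square mult_ac)
  qed
  also have "\<dots> \<le> q"
    using mult_right_mono[OF u q0] by (simp add: l1norm_def sum_distrib_right)
  finally have "q * q \<le> 1 * q" by (simp add: power2_eq_square)
  then have "q \<le> 1" using q0 by (cases "q = 0") (auto simp: mult_le_cancel_right)
  then have "w i * q \<le> w i" using w_pos[OF i] by (simp add: mult_left_le)
  with le[OF i] show ?thesis by simp
qed

text \<open>Dividing the Lewis equation by \<open>w i\<close> and summing turns the left side into
  the trace of \<open>B\<close> times the weighted Gram matrix, which is the identity of size
  \<open>d\<close>.\<close>

lemma sum_weights: "(\<Sum>i<n. w i) = real d"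
proof -
  have delta: "(\<Sum>k<d. B j k * (\<Sum>i<n. X i k * X i j / w i)) = 1" if "j < d" for j
    using inverse that by (simp add: is_inverse_def matmul_def)
  have "w i = (\<Sum>j<d. \<Sum>k<d. B j k * (X i k * X i j / w i))" if "i < n" for i
  proof -
    have "w i = (w i)\<^sup>2 / w i" using w_pos[OF that] by (simp add: power2_eq_square)
    also have "\<dots> = (\<Sum>j<d. \<Sum>k<d. B j k * (X i k * X i j / w i))"
      unfolding w_square[OF that] by (simp add: sum_divide_distrib mult_ac)
    finally show ?thesis .
  qed
  then have "(\<Sum>i<n. w i) = (\<Sum>i<n. \<Sum>j<d. \<Sum>k<d. B j k * (X i k * X i j / w i))"
    by simp
  also have "\<dots> = (\<Sum>j<d. \<Sum>k<d. \<Sum>i<n. B j k * (X i k * X i j / w i))"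
    by (simp add: sum.swap[of _ _ "{..<n}"])
  also have "\<dots> = (\<Sum>j<d. \<Sum>k<d. B j k * (\<Sum>i<n. X i k * X i j / w i))"
    by (simp only: sum_distrib_left)
  also have "\<dots> = (\<Sum>j<d. 1)"
    using delta by (intro sum.cong refl) auto
  finally show ?thesis by simp
qed

text \<open>The point where the dimension d, rather than the number of rows, enters: the coefficients
  of u in the kernel expansion form a sub-probability vector dominated by the weights.\<close>

lemma exp_inner_le:
  assumes u: "l1norm n (matvec d X u) \<le> 1"
  shows "exp (\<Sum>j<d. v j * u j) \<le> 1 - real d + (\<Sum>i<n. w i * (exp (score v i / w i) + exp (- (score v i / w i))))"
proof -
  define c where "c i = \<bar>matvec d X u i\<bar>" for i
  have "(\<Sum>j<d. v j * u j) \<le> (\<Sum>i<n. c i * \<bar>score v i / w i\<bar>)"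
    unfolding inner_eq_sum_score c_def
  proof (rule sum_mono)
    fix i assume "i \<in> {..<n}"
    have "score v i * matvec d X u i / w i \<le> \<bar>score v i * matvec d X u i / w i\<bar>" by (rule abs_ge_self)
    then show "score v i * matvec d X u i / w i \<le> \<bar>matvec d X u i\<bar> * \<bar>score v i / w i\<bar>"
      by (simp add: abs_mult mult.commute)
  qed
  then have "exp (\<Sum>j<d. v j * u j) \<le> exp (\<Sum>i<n. c i * \<bar>score v i / w i\<bar>)" by simp
  also have "\<dots> \<le> 1 + (\<Sum>i<n. c i * (exp \<bar>score v i / w i\<bar> - 1))"
    using u by (intro exp_sum_le) (auto simp: c_def l1norm_def)
  \<comment> \<open>Enlarging \<open>c i\<close> to \<open>w i\<close> is sound because
    \<open>exp \<bar>x\<bar> - 1\<close> is nonnegative. Replacing \<open>exp \<bar>x\<bar>\<close>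
    by \<open>exp x + exp (- x)\<close> makes the bound factorize under later signed increments of
    \<open>v\<close>.\<close>
  also have "\<dots> \<le> 1 + (\<Sum>i<n. w i * (exp (score v i / w i) + exp (- (score v i / w i)) - 1))"
  proof (intro add_left_mono sum_mono mult_mono)
    fix i assume "i \<in> {..<n}"
    then show "c i \<le> w i" "w i \<ge> 0" using abs_matvec_le[OF u] w_pos[of i] by (auto simp: c_def)
    show "exp \<bar>score v i / w i\<bar> - 1 \<le> exp (score v i / w i) + exp (- (score v i / w i)) - 1"
      by (simp add: abs_if)
  qed auto
  also have "\<dots> = 1 - real d + (\<Sum>i<n. w i * (exp (score v i / w i) + exp (- (score v i / w i))))"
    by (simp add: algebra_simps sum.distrib sum_subtractf sum_weights)
  finally show ?thesis .
qed

section \<open>Exponential moments of the signed walk\<close>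

lemma exp_add_exp_minus_le:
  fixes x :: real
  assumes "\<bar>x\<bar> \<le> 1"
  shows "exp x + exp (- x) \<le> 2 * (1 + x\<^sup>2)"
proof -
  have *: "exp x + exp (- x) \<le> 2 * (1 + x\<^sup>2)" if x: "0 \<le> x" "x \<le> 1" for x :: real
  proof -
    have "exp (- x) \<le> 1 / (1 + x)"
      using exp_ge_add_one_self[of x] x by (simp add: exp_minus inverse_eq_divide frac_le)
    also have "\<dots> \<le> 1 - x + x\<^sup>2"
    proof -
      have "1 \<le> (1 - x + x\<^sup>2) * (1 + x)"
        using x by (simp add: algebra_simps power2_eq_square)
      then show ?thesis using x by (simp add: divide_le_eq)
    qed
    finally show ?thesis using exp_bound[OF x] by simp
  qed
  show ?thesis using *[of x] *[of "- x"] assms by (cases "x \<ge> 0") auto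
qed

text \<open>A signed increment keeps the functional linear and moves \<open>v\<close> by plus or
  minus \<open>2 * a i\<close> times the row \<open>X i\<close>, so \<open>exp_inner_le\<close> is
  applied only at the end. Averaging over the sign factorizes by the product formula for the
  hyperbolic cosine, hence each step multiplies the weighted sum by at most
  \<open>c\<close>.\<close>

lemma signed_walk_le:
  assumes T: "finite T" "T \<noteq> {}" "\<And>u. u \<in> T \<Longrightarrow> l1norm n (matvec d X u) \<le> 1"
    and q: "\<And>i. i < n \<Longrightarrow> q i \<ge> 0" "(\<Sum>i<n. q i) = 1"
    and c: "\<And>j. j < n \<Longrightarrow>
      (\<Sum>i<n. q i * ((exp (2 * a i * score (X i) j / w j) + exp (- (2 * a i * score (X i) j / w j))) / 2)) \<le> c"
  shows "signed_walk T n q (\<lambda>i u. a i * matvec d X u i) r (\<lambda>u. \<Sum>j<d. v j * u j)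
    \<le> 1 - real d + c ^ r * (\<Sum>i<n. w i * (exp (score v i / w i) + exp (- (score v i / w i))))"
proof (induction r arbitrary: v)
  case 0
  obtain u where "u \<in> T" "exp_max T (\<lambda>u. \<Sum>j<d. v j * u j) = exp (\<Sum>j<d. v j * u j)"
    using exp_max_attained[OF T(1,2), of "\<lambda>u. \<Sum>j<d. v j * u j"] by blast
  then show ?case using exp_inner_le[OF T(3), of u v] by simp
next
  case (Suc r)
  define E where "E v = (\<Sum>i<n. w i * (exp (score v i / w i) + exp (- (score v i / w i))))" for v
  define vp where "vp i = (\<lambda>j. v j + (2 * a i) * X i j)" for i
  define vm where "vm i = (\<lambda>j. v j + (- 2 * a i) * X i j)" for i
  have cr: "c ^ r \<ge> 0"
  proof (cases "n = 0")
    case True then show ?thesis using q by simp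
  next
    case False
    have "0 \<le> (\<Sum>i<n. q i * ((exp (2 * a i * score (X i) 0 / w 0) + exp (- (2 * a i * score (X i) 0 / w 0))) / 2))"
      using q by (intro sum_nonneg mult_nonneg_nonneg) auto
    then show ?thesis using c[of 0] False by simp
  qed
  have "(\<lambda>u. (\<Sum>j<d. v j * u j) + 2 * (a i * matvec d X u i)) = (\<lambda>u. \<Sum>j<d. vp i j * u j)" for i
    by (rule ext) (simp add: vp_def matvec_def algebra_simps sum.distrib sum_distrib_left)
  moreover have "(\<lambda>u. (\<Sum>j<d. v j * u j) - 2 * (a i * matvec d X u i)) = (\<lambda>u. \<Sum>j<d. vm i j * u j)" for i
    by (rule ext) (simp add: vm_def matvec_def algebra_simps sum.distrib sum_subtractf sum_distrib_left)
  ultimately have "signed_walk T n q (\<lambda>i u. a i * matvec d X u i) (Suc r) (\<lambda>u. \<Sum>j<d. v j * u j)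
     = (\<Sum>i<n. q i * ((signed_walk T n q (\<lambda>i u. a i * matvec d X u i) r (\<lambda>u. \<Sum>j<d. vp i j * u j)
        + signed_walk T n q (\<lambda>i u. a i * matvec d X u i) r (\<lambda>u. \<Sum>j<d. vm i j * u j)) / 2))"
    by simp
  also have "\<dots> \<le> (\<Sum>i<n. q i * (((1 - real d + c ^ r * E (vp i)) + (1 - real d + c ^ r * E (vm i))) / 2))"
    unfolding E_def using q by (intro sum_mono mult_left_mono divide_right_mono add_mono Suc.IH) auto
  also have "\<dots> = 1 - real d + c ^ r * (\<Sum>i<n. q i * ((E (vp i) + E (vm i)) / 2))"
  proof -
    have "(\<Sum>i<n. q i * (((1 - real d + c ^ r * E (vp i)) + (1 - real d + c ^ r * E (vm i))) / 2))
        = (\<Sum>i<n. q i * (1 - real d) + c ^ r * (q i * ((E (vp i) + E (vm i)) / 2)))"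
      by (intro sum.cong refl) (simp add: field_simps)
    also have "\<dots> = (\<Sum>i<n. q i) * (1 - real d) + c ^ r * (\<Sum>i<n. q i * ((E (vp i) + E (vm i)) / 2))"
      by (simp only: sum.distrib sum_distrib_left sum_distrib_right)
    finally show ?thesis using q by simp
  qed
  also have "(\<Sum>i<n. q i * ((E (vp i) + E (vm i)) / 2)) \<le> c * E v"
  proof -
    define g where "g i j = (exp (2 * a i * score (X i) j / w j) + exp (- (2 * a i * score (X i) j / w j))) / 2" for i j
    define e where "e j = exp (score v j / w j) + exp (- (score v j / w j))" for j
    have E: "(E (vp i) + E (vm i)) / 2 = (\<Sum>j<n. w j * (e j * g i j))" for i
    proof -
      have "exp (score (vp i) j / w j) + exp (- (score (vp i) j / w j))
          + (exp (score (vm i) j / w j) + exp (- (score (vm i) j / w j))) = 2 * (e j * g i j)" for j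
        unfolding vp_def vm_def score_add score_scale e_def g_def add_divide_distrib minus_add_distrib exp_add
        by (simp add: field_simps)
      then have "E (vp i) + E (vm i) = (\<Sum>j<n. 2 * (w j * (e j * g i j)))"
        unfolding E_def sum.distrib[symmetric] distrib_left[symmetric] by (simp add: mult_ac)
      then show ?thesis by (simp flip: sum_distrib_left)
    qed
    have "(\<Sum>i<n. q i * ((E (vp i) + E (vm i)) / 2)) = (\<Sum>j<n. w j * e j * (\<Sum>i<n. q i * g i j))"
      unfolding E sum_distrib_left by (subst sum.swap) (simp add: mult_ac)
    also have "\<dots> \<le> (\<Sum>j<n. w j * e j * c)"
      using c w_pos unfolding g_def e_def by (intro sum_mono mult_left_mono) (auto simp: less_imp_le)
    also have "\<dots> = c * E v"
      by (simp add: E_def e_def sum_distrib_left mult_ac)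
    finally show ?thesis .
  qed
  then have "1 - real d + c ^ r * (\<Sum>i<n. q i * ((E (vp i) + E (vm i)) / 2)) \<le> 1 - real d + c ^ r * (c * E v)"
    using cr by (intro add_left_mono mult_left_mono) auto
  finally show ?case by (simp add: E_def mult_ac)
qed

text \<open>With probabilities \<open>w i / real d\<close> and scaling \<open>s / w i\<close>, the
  second moment of the exponent at \<open>j\<close> is exactly \<open>4 * s\<^sup>2 / real d\<close>
  by \<open>sum_score_row_square\<close>, independently of \<open>j\<close>. The condition
  \<open>2 * s \<le> 1\<close> keeps the exponents in the range of
  \<open>exp_add_exp_minus_le\<close>.\<close>

lemma signed_walk_lewis_le:
  assumes T: "finite T" "T \<noteq> {}" "\<And>u. u \<in> T \<Longrightarrow> l1norm n (matvec d X u) \<le> 1"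
    and d: "d \<ge> 1" and s: "0 \<le> s" "2 * s \<le> 1"
  shows "signed_walk T n (\<lambda>i. w i / real d) (\<lambda>i u. s / w i * matvec d X u i) r (\<lambda>u. 0)
    \<le> 2 * real d * exp (4 * s\<^sup>2 / real d * real r)"
proof -
  define c where "c = 1 + 4 * s\<^sup>2 / real d"
  \<comment> \<open>The start \<open>h = 0\<close> is the linear functional with
    \<open>v = 0\<close>, for which the weighted sum equals \<open>2 * real d\<close>.\<close>
  have "signed_walk T n (\<lambda>i. w i / real d) (\<lambda>i u. s / w i * matvec d X u i) r (\<lambda>u. \<Sum>j<d. 0 * u j)
    \<le> 1 - real d + c ^ r * (\<Sum>i<n. w i * (exp (score (\<lambda>_. 0) i / w i) + exp (- (score (\<lambda>_. 0) i / w i))))"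
  proof (rule signed_walk_le[OF T])
    show "(\<Sum>i<n. w i / real d) = 1" using sum_weights d by (simp flip: sum_divide_distrib)
    fix j assume j: "j < n"
    define x where "x i = 2 * (s / w i) * score (X i) j / w j" for i
    have "(\<Sum>i<n. w i / real d * ((exp (x i) + exp (- x i)) / 2)) \<le> (\<Sum>i<n. w i / real d * (1 + (x i)\<^sup>2))"
    proof (intro sum_mono mult_left_mono)
      fix i assume i: "i \<in> {..<n}"
      have "\<bar>x i\<bar> = 2 * s * (\<bar>score (X i) j\<bar> / (w i * w j))"
        using i j w_pos[of i] w_pos[of j] s by (simp add: x_def abs_mult)
      also have "\<dots> \<le> 2 * s * 1"
        using i j w_pos[of i] w_pos[of j] s abs_score_row_le[of i j] by (intro mult_left_mono) auto
      finally have "\<bar>x i\<bar> \<le> 1" using s by simp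
      then show "(exp (x i) + exp (- x i)) / 2 \<le> 1 + (x i)\<^sup>2"
        using exp_add_exp_minus_le[of "x i"] by simp
    qed (use w_pos in \<open>auto simp: less_imp_le\<close>)
    also have "\<dots> = (\<Sum>i<n. w i / real d) + (\<Sum>i<n. 4 * s\<^sup>2 / real d / (w j)\<^sup>2 * ((score (X j) i)\<^sup>2 / w i))"
    proof -
      have "w i / real d * (1 + (x i)\<^sup>2) = w i / real d + 4 * s\<^sup>2 / real d / (w j)\<^sup>2 * ((score (X j) i)\<^sup>2 / w i)"
        if "i < n" for i
        using w_pos[OF that] w_pos[OF j] d
        by (simp add: x_def score_row_commute[of i j] power2_eq_square field_simps)
      then show ?thesis by (simp flip: sum.distrib)
    qed
    also have "\<dots> = c"
      unfolding sum_distrib_left[symmetric] sum_divide_distrib[symmetric] sum_score_row_square[OF j] sum_weights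
      using d w_pos[OF j] by (simp add: c_def)
    finally show "(\<Sum>i<n. w i / real d * ((exp (2 * (s / w i) * score (X i) j / w j)
        + exp (- (2 * (s / w i) * score (X i) j / w j))) / 2)) \<le> c"
      by (simp add: x_def)
  qed (use w_pos in \<open>auto simp: less_imp_le\<close>)
  also have "(\<Sum>i<n. w i * (exp (score (\<lambda>_. 0) i / w i) + exp (- (score (\<lambda>_. 0) i / w i)))) = 2 * real d"
    by (simp add: score_def sum_weights flip: sum_distrib_right)
  also have "1 - real d + c ^ r * (2 * real d) \<le> c ^ r * (2 * real d)" using d by simp
  also have "c ^ r \<le> exp (4 * s\<^sup>2 / real d) ^ r"
    unfolding c_def by (intro power_mono exp_ge_add_one_self) auto
  also have "\<dots> = exp (4 * s\<^sup>2 / real d * real r)"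
    by (simp add: mult.commute flip: exp_of_nat_mult)
  finally show ?thesis using d by (simp add: mult_ac)
qed

end

subsection \<open>Reduction to one-sided deviations on the unit ball\<close>

lemma matvec_add_scale:
  "matvec d X (\<lambda>j. u j + c * v j) i = matvec d X u i + c * matvec d X v i"
  by (simp add: matvec_def algebra_simps sum.distrib sum_distrib_left)

lemma matvec_scale: "matvec d X (\<lambda>j. c * v j) i = c * matvec d X v i"
  by (simp add: matvec_def algebra_simps sum_distrib_left)

lemma sketched_obj_eq:
  assumes "\<And>r. r < N \<Longrightarrow> k r < n" "\<And>i. i < n \<Longrightarrow> p i \<ge> 0"
  shows "sketched_obj n d N X y p k \<beta> = (\<Sum>r<N. \<bar>matvec d X \<beta> (k r) - y (k r)\<bar> / p (k r))"
proof -
  have sk: "(\<Sum>i<n. sketch_matrix p k r i * g i) = g (k r) / p (k r)" if "r < N" for r and g :: "nat \<Rightarrow> real"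
    using assms(1)[OF that] by (simp add: sketch_matrix_def if_distrib[of "\<lambda>x. x * _"] cong: if_cong)
  have "matvec d (matmul n (sketch_matrix p k) X) \<beta> r - matvec n (sketch_matrix p k) y r
      = (matvec d X \<beta> (k r) - y (k r)) / p (k r)" if "r < N" for r
    unfolding matvec_def matmul_def sk[OF that] by (simp add: sum_divide_distrib diff_divide_distrib)
  then show ?thesis
    using assms by (simp add: sketched_obj_def l1norm_def)
qed

lemma INF_full_obj_eq:
  assumes "\<And>\<beta>. full_obj n d X y b \<le> full_obj n d X y \<beta>"
  shows "(INF \<beta>. full_obj n d X y \<beta>) = full_obj n d X y b"
  using assms by (intro cInf_eq_minimum) auto

text \<open>A direction t that is bad for the full objective can be rescaled to lie in the unit ball:
  by convexity if t is long compared with the optimum, by homogeneity if the optimum is 0.\<close>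

lemma normalized_bad_direction:
  fixes t e :: "nat \<Rightarrow> real"
  assumes \<epsilon>: "0 < \<epsilon>" "\<epsilon> < 1"
    and bad: "(\<Sum>i<n. \<bar>t i - e i\<bar>) > (1 + \<epsilon>) * (\<Sum>i<n. \<bar>e i\<bar>)"
    and R: "R = (if (\<Sum>i<n. \<bar>e i\<bar>) = 0 then 1 else 4 * (\<Sum>i<n. \<bar>e i\<bar>))"
  obtains c C where "C \<ge> 0" "(\<Sum>i<n. \<bar>c * t i\<bar>) \<le> 1"
    "(\<Sum>i<n. \<bar>c * t i - e i / R\<bar> - \<bar>e i / R\<bar>) \<ge> \<epsilon> / 4"
    "\<And>i. i < n \<Longrightarrow> \<bar>c * t i - e i / R\<bar> - \<bar>e i / R\<bar> \<le> C * (\<bar>t i - e i\<bar> - \<bar>e i\<bar>)"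
proof -
  define O' where "O' = (\<Sum>i<n. \<bar>e i\<bar>)"
  define S where "S = (\<Sum>i<n. \<bar>t i\<bar>)"
  have O0: "O' \<ge> 0" and S0: "S \<ge> 0" by (auto simp: O'_def S_def intro: sum_nonneg)
  have sum_scale: "(\<Sum>i<n. \<bar>c * t i\<bar>) = c * S" if "c \<ge> 0" for c
    using that by (simp add: S_def abs_mult sum_distrib_left)
  show thesis
  proof (cases "O' = 0")
    case True
    then have e: "e i = 0" if "i < n" for i
      using that by (auto simp: O'_def sum_nonneg_eq_0_iff)
    have S: "S > 0" using bad True e by (simp add: S_def O'_def)
    show thesis
    proof (rule that[of "1 / S" "1 / S"])
      show "(\<Sum>i<n. \<bar>1 / S * t i\<bar>) \<le> 1" using sum_scale[of "1 / S"] S by simp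
      show "\<epsilon> / 4 \<le> (\<Sum>i<n. \<bar>1 / S * t i - e i / R\<bar> - \<bar>e i / R\<bar>)"
        using sum_scale[of "1 / S"] S \<epsilon> e by simp
      show "\<bar>1 / S * t i - e i / R\<bar> - \<bar>e i / R\<bar> \<le> 1 / S * (\<bar>t i - e i\<bar> - \<bar>e i\<bar>)" if "i < n" for i
        using e[OF that] S by simp
    qed (use S in simp)
  next
    case False
    then have O: "O' > 0" using O0 by simp
    have RO: "R = 4 * O'" using False by (simp add: R O'_def)
    have R0: "R > 0" using O RO by simp
    show thesis
    proof (cases "S \<le> R")
      \<comment> \<open>Short direction: dividing everything by \<open>R\<close> turns the excess
        \<open>\<epsilon> * O'\<close> into \<open>\<epsilon> / 4\<close>, which is what the factor
        4 in \<open>R\<close> provides.\<close>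
      case True
      have eq: "\<bar>1 / R * t i - e i / R\<bar> - \<bar>e i / R\<bar> = 1 / R * (\<bar>t i - e i\<bar> - \<bar>e i\<bar>)" for i
      proof -
        have "1 / R * t i - e i / R = (t i - e i) / R" by (simp add: diff_divide_distrib)
        moreover have "\<bar>(t i - e i) / R\<bar> = \<bar>t i - e i\<bar> / R" "\<bar>e i / R\<bar> = \<bar>e i\<bar> / R" using R0 by simp_all
        ultimately show ?thesis by (simp only:) (simp add: diff_divide_distrib)
      qed
      show thesis
      proof (rule that[of "1 / R" "1 / R"])
        show "(\<Sum>i<n. \<bar>1 / R * t i\<bar>) \<le> 1" using sum_scale[of "1 / R"] R0 True by simp
        have "\<epsilon> / 4 = \<epsilon> * O' / R" using RO O by simp
        also have "\<dots> \<le> ((\<Sum>i<n. \<bar>t i - e i\<bar>) - O') / R"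
          using bad R0 by (intro divide_right_mono) (auto simp: O'_def algebra_simps)
        also have "\<dots> = (\<Sum>i<n. \<bar>1 / R * t i - e i / R\<bar> - \<bar>e i / R\<bar>)"
          unfolding eq by (simp add: O'_def sum_subtractf flip: sum_divide_distrib)
        finally show "\<epsilon> / 4 \<le> (\<Sum>i<n. \<bar>1 / R * t i - e i / R\<bar> - \<bar>e i / R\<bar>)" .
      qed (use R0 eq in auto)
    next
      \<comment> \<open>Long direction: \<open>c * t\<close> has norm 1, and the triangle inequality
        loses at most \<open>2 * O' / R = 1 / 2\<close>, leaving more than
        \<open>\<epsilon> / 4\<close>.\<close>
      case False
      then have S: "S > 0" "R < S" using R0 by auto
      show thesis
      proof (rule that[of "1 / S" "1 / S"])
        show "(\<Sum>i<n. \<bar>1 / S * t i\<bar>) \<le> 1" using sum_scale[of "1 / S"] S by simp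
        have "(\<Sum>i<n. \<bar>1 / S * t i\<bar> - 2 * (\<bar>e i\<bar> / R)) = 1 - 2 * (O' / R)"
          using sum_scale[of "1 / S"] S by (simp add: sum_subtractf O'_def flip: sum_divide_distrib sum_distrib_left)
        also have "\<dots> = 1 / 2" using RO O by simp
        finally have "1 / 2 = (\<Sum>i<n. \<bar>1 / S * t i\<bar> - 2 * (\<bar>e i\<bar> / R))" ..
        also have "\<dots> \<le> (\<Sum>i<n. \<bar>1 / S * t i - e i / R\<bar> - \<bar>e i / R\<bar>)"
        proof (rule sum_mono)
          fix i
          have "\<bar>e i / R\<bar> = \<bar>e i\<bar> / R" using R0 by simp
          then show "\<bar>1 / S * t i\<bar> - 2 * (\<bar>e i\<bar> / R) \<le> \<bar>1 / S * t i - e i / R\<bar> - \<bar>e i / R\<bar>"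
            by linarith
        qed
        finally show "\<epsilon> / 4 \<le> (\<Sum>i<n. \<bar>1 / S * t i - e i / R\<bar> - \<bar>e i / R\<bar>)" using \<epsilon> by linarith
        show "\<bar>1 / S * t i - e i / R\<bar> - \<bar>e i / R\<bar> \<le> 1 / S * (\<bar>t i - e i\<bar> - \<bar>e i\<bar>)" for i
        proof -
          \<comment> \<open>Since \<open>1 / S < 1 / R\<close>, the second summand has absolute
            value \<open>(1 / R - 1 / S) * \<bar>e i\<bar>\<close>; subtracting
            \<open>\<bar>e i\<bar> / R\<close> then leaves exactly the multiple \<open>1 / S\<close>
            of the original increase.\<close>
          have "1 / S * t i - e i / R = 1 / S * (t i - e i) + (1 / S - 1 / R) * e i"
            by (simp add: algebra_simps)
          then have "\<bar>1 / S * t i - e i / R\<bar> \<le> \<bar>1 / S * (t i - e i)\<bar> + \<bar>(1 / S - 1 / R) * e i\<bar>"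
            by (metis abs_triangle_ineq)
          also have "\<bar>1 / S * (t i - e i)\<bar> = 1 / S * \<bar>t i - e i\<bar>" using S by (simp add: abs_mult)
          also have "\<bar>(1 / S - 1 / R) * e i\<bar> = (1 / R - 1 / S) * \<bar>e i\<bar>"
            using S R0 by (simp add: abs_mult frac_le less_imp_le)
          finally show ?thesis using R0 by (simp add: algebra_simps)
        qed
      qed (use S in simp)
    qed
  qed
qed

text \<open>The order of quantifiers matters: \<open>z\<close> is the normalized residual at the
  optimum \<open>b\<close>, fixed before the sample \<open>k\<close>, so the functions to be
  contracted do not depend on the sample. The sampled increase is nonpositive because a sketched
  minimizer does no worse than \<open>b\<close> on the sketch.\<close>

lemma bad_event_witness:
  fixes y :: "nat \<Rightarrow> real"
  assumes \<epsilon>: "0 < \<epsilon>" "\<epsilon> < 1"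
    and p: "\<And>i. i < n \<Longrightarrow> p i > 0"
    and b: "\<And>\<beta>. full_obj n d X y b \<le> full_obj n d X y \<beta>"
  shows "\<exists>z. \<forall>k. (\<forall>r<N. k r < n) \<longrightarrow> k \<notin> good_event n d N X y p \<epsilon> \<longrightarrow>
    (\<exists>u. l1norm n (matvec d X u) \<le> 1 \<and>
      (\<Sum>i<n. \<bar>matvec d X u i - z i\<bar> - \<bar>z i\<bar>) \<ge> \<epsilon> / 4 \<and>
      (\<Sum>r<N. (\<bar>matvec d X u (k r) - z (k r)\<bar> - \<bar>z (k r)\<bar>) / p (k r)) \<le> 0)"
proof -
  define e where "e i = y i - matvec d X b i" for i
  define R where "R = (if (\<Sum>i<n. \<bar>e i\<bar>) = 0 then 1 else 4 * (\<Sum>i<n. \<bar>e i\<bar>))"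
  have OPT: "(INF \<beta>. full_obj n d X y \<beta>) = (\<Sum>i<n. \<bar>e i\<bar>)"
    by (simp add: INF_full_obj_eq[OF b]) (simp add: full_obj_def l1norm_def e_def abs_minus_commute)
  show ?thesis
  proof (rule exI[of _ "\<lambda>i. e i / R"], intro allI impI)
    fix k assume "\<forall>r<N. k r < n" and "k \<notin> good_event n d N X y p \<epsilon>"
    then have k: "\<And>r. r < N \<Longrightarrow> k r < n" by simp
    from \<open>k \<notin> good_event n d N X y p \<epsilon>\<close>
    obtain \<beta> where min: "is_arg_min (sketched_obj n d N X y p k) (\<lambda>_. True) \<beta>"
      and big: "full_obj n d X y \<beta> > (1 + \<epsilon>) * (\<Sum>i<n. \<bar>e i\<bar>)"
      by (auto simp: good_event_def OPT not_le)
    define t where "t i = matvec d X \<beta> i - matvec d X b i" for i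
    have te: "t i - e i = matvec d X \<beta> i - y i" for i by (simp add: t_def e_def)
    have "(\<Sum>i<n. \<bar>t i - e i\<bar>) > (1 + \<epsilon>) * (\<Sum>i<n. \<bar>e i\<bar>)"
      using big by (simp add: full_obj_def l1norm_def te)
    then obtain c C where cC: "C \<ge> 0" "(\<Sum>i<n. \<bar>c * t i\<bar>) \<le> 1"
      "(\<Sum>i<n. \<bar>c * t i - e i / R\<bar> - \<bar>e i / R\<bar>) \<ge> \<epsilon> / 4"
      "\<And>i. i < n \<Longrightarrow> \<bar>c * t i - e i / R\<bar> - \<bar>e i / R\<bar> \<le> C * (\<bar>t i - e i\<bar> - \<bar>e i\<bar>)"
      by (rule normalized_bad_direction[OF \<epsilon> _ R_def]) (rule that; assumption)
    have mv: "matvec d X (\<lambda>j. c * (\<beta> j + (-1) * b j)) i = c * t i" for i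
      unfolding matvec_scale matvec_add_scale by (simp add: t_def)
    have p0: "\<And>i. i < n \<Longrightarrow> 0 \<le> p i" using p by (simp add: less_imp_le)
    have "sketched_obj n d N X y p k \<beta> \<le> sketched_obj n d N X y p k b"
      using min by (auto simp: is_arg_min_def not_less)
    then have "(\<Sum>r<N. \<bar>t (k r) - e (k r)\<bar> / p (k r)) \<le> (\<Sum>r<N. \<bar>e (k r)\<bar> / p (k r))"
      by (simp add: sketched_obj_eq[of N k n p, OF k p0] te) (simp add: e_def abs_minus_commute)
    then have sk: "(\<Sum>r<N. (\<bar>t (k r) - e (k r)\<bar> - \<bar>e (k r)\<bar>) / p (k r)) \<le> 0"
      by (simp add: diff_divide_distrib sum_subtractf)
    have "(\<Sum>r<N. (\<bar>c * t (k r) - e (k r) / R\<bar> - \<bar>e (k r) / R\<bar>) / p (k r))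
        \<le> (\<Sum>r<N. C * ((\<bar>t (k r) - e (k r)\<bar> - \<bar>e (k r)\<bar>) / p (k r)))"
    proof (rule sum_mono)
      fix r assume "r \<in> {..<N}"
      then show "(\<bar>c * t (k r) - e (k r) / R\<bar> - \<bar>e (k r) / R\<bar>) / p (k r)
        \<le> C * ((\<bar>t (k r) - e (k r)\<bar> - \<bar>e (k r)\<bar>) / p (k r))"
        using divide_right_mono[OF cC(4) p0] k by simp
    qed
    also have "\<dots> \<le> 0"
      unfolding sum_distrib_left[symmetric] using sk cC(1) by (intro mult_nonneg_nonpos)
    finally show "\<exists>u. l1norm n (matvec d X u) \<le> 1 \<and>
      (\<Sum>i<n. \<bar>matvec d X u i - e i / R\<bar> - \<bar>e i / R\<bar>) \<ge> \<epsilon> / 4 \<and>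
      (\<Sum>r<N. (\<bar>matvec d X u (k r) - e (k r) / R\<bar> - \<bar>e (k r) / R\<bar>) / p (k r)) \<le> 0"
      using cC(2,3) unfolding mv[symmetric] l1norm_def by blast
  qed
qed

section \<open>Mass function and support of the sampling distribution\<close>

lemma pmf_row_pmf:
  assumes "\<And>i. i < n \<Longrightarrow> p i \<ge> 0" "(\<Sum>i<n. p i) = real N" "N > 0"
  shows "pmf (row_pmf n p N) i = (if i < n then p i / real N else 0)"
  unfolding row_pmf_def
proof (rule pmf_embed_pmf)
  show "0 \<le> (if i < n then p i / real N else 0)" for i using assms by simp
  have "(\<integral>\<^sup>+ i. ennreal (if i < n then p i / real N else 0) \<partial>count_space UNIV)
      = (\<Sum>i<n. ennreal (if i < n then p i / real N else 0))"
    by (rule nn_integral_count_space') auto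
  also have "\<dots> = (\<Sum>i<n. ennreal (p i / real N))" by simp
  also have "\<dots> = ennreal (\<Sum>i<n. p i / real N)" using assms by (intro sum_ennreal) auto
  also have "(\<Sum>i<n. p i / real N) = 1" using assms by (simp flip: sum_divide_distrib)
  finally show "(\<integral>\<^sup>+ i. ennreal (if i < n then p i / real N else 0) \<partial>count_space UNIV) = 1" by simp
qed

lemma set_row_pmf:
  assumes "\<And>i. i < n \<Longrightarrow> p i \<ge> 0" "(\<Sum>i<n. p i) = real N" "N > 0"
  shows "set_pmf (row_pmf n p N) \<subseteq> {..<n}"
  by (auto simp: set_pmf_eq pmf_row_pmf[OF assms] split: if_splits)

lemma set_sampling_pmf:
  assumes "\<And>i. i < n \<Longrightarrow> p i \<ge> 0" "(\<Sum>i<n. p i) = real N" "N > 0"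
  shows "finite (set_pmf (sampling_pmf n p N))"
    and "k \<in> set_pmf (sampling_pmf n p N) \<Longrightarrow> r < N \<Longrightarrow> k r < n"
proof -
  have set: "set_pmf (sampling_pmf n p N) = PiE_dflt {..<N} 0 (\<lambda>_. set_pmf (row_pmf n p N))"
    by (simp add: sampling_pmf_def set_Pi_pmf o_def)
  show "finite (set_pmf (sampling_pmf n p N))"
    unfolding set by (intro finite_PiE_dflt finite_subset[OF set_row_pmf[OF assms]]) auto
  show "k r < n" if "k \<in> set_pmf (sampling_pmf n p N)" "r < N"
    using that set_row_pmf[OF assms] by (auto simp: set PiE_dflt_def)
qed

section \<open>Existence of an optimum and the tail bound for the failure probability\<close>

context lewis_design
begin

text \<open>Applying \<open>inner_eq_sum_score\<close> to unit vectors bounds every coordinate by a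
  multiple of the norm of \<open>X \<beta>\<close>, so minimizing over a compact box
  suffices.\<close>

lemma full_obj_attains: "\<exists>b. \<forall>\<beta>. full_obj n d X y b \<le> full_obj n d X y \<beta>"
proof -
  define \<kappa> where "\<kappa> = (\<Sum>j<d. \<Sum>i<n. \<bar>score (\<lambda>l. if l = j then 1 else 0) i / w i\<bar>)"
  have \<kappa>: "\<bar>\<beta> j\<bar> \<le> \<kappa> * l1norm n (matvec d X \<beta>)" if j: "j < d" for \<beta> j
  proof -
    let ?s = "\<lambda>i. score (\<lambda>l. if l = j then 1 else 0) i / w i"
    have s: "\<bar>?s i\<bar> \<le> \<kappa>" if "i < n" for i
    proof -
      have "\<bar>?s i\<bar> \<le> (\<Sum>i<n. \<bar>?s i\<bar>)" using that by (intro member_le_sum) auto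
      also have "\<dots> \<le> \<kappa>"
        unfolding \<kappa>_def using j
        by (intro member_le_sum[of j "{..<d}" "\<lambda>j. \<Sum>i<n. \<bar>score (\<lambda>l. if l = j then 1 else 0) i / w i\<bar>"] sum_nonneg) auto
      finally show ?thesis .
    qed
    have "\<beta> j = (\<Sum>l<d. (if l = j then 1 else 0) * \<beta> l)"
      using j by (simp add: if_distrib[of "\<lambda>x. x * _"] cong: if_cong)
    also have "\<dots> = (\<Sum>i<n. ?s i * matvec d X \<beta> i)"
      by (subst inner_eq_sum_score) simp
    finally have "\<bar>\<beta> j\<bar> \<le> (\<Sum>i<n. \<bar>?s i * matvec d X \<beta> i\<bar>)" by (simp only: sum_abs)
    also have "\<dots> \<le> (\<Sum>i<n. \<kappa> * \<bar>matvec d X \<beta> i\<bar>)"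
      unfolding abs_mult using s by (intro sum_mono mult_right_mono) auto
    finally show ?thesis by (simp add: l1norm_def sum_distrib_left)
  qed
  have \<kappa>0: "\<kappa> \<ge> 0" unfolding \<kappa>_def by (intro sum_nonneg) auto
  define f0 where "f0 = l1norm n y"
  \<comment> \<open>Any point at least as good as 0 has
    \<open>l1norm n (matvec d X \<beta>) \<le> 2 * f0\<close>, which sets the radius. Coordinates
    from \<open>d\<close> on do not affect the objective and are pinned to 0 to make the product
    compact.\<close>
  define S where "S j = (if j < d then {- (\<kappa> * (2 * f0))..\<kappa> * (2 * f0)} else {0})" for j
  have f0: "f0 \<ge> 0" by (auto simp: f0_def l1norm_def intro: sum_nonneg)
  have zero: "full_obj n d X y (\<lambda>_. 0) = f0"
    by (simp add: full_obj_def f0_def l1norm_def matvec_def)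
  have "compactin (product_topology (\<lambda>_. euclidean) UNIV) (PiE UNIV S)"
    by (subst compactin_PiE) (auto simp: S_def compactin_euclidean_iff)
  then have "compact (PiE UNIV S)"
    by (simp add: euclidean_product_topology compactin_euclidean_iff)
  moreover have Z: "(\<lambda>_. 0) \<in> PiE UNIV S" using f0 \<kappa>0 by (auto simp: S_def)
  moreover have "continuous_on (PiE UNIV S) (full_obj n d X y)"
  proof -
    have "continuous_on UNIV (\<lambda>\<beta>. full_obj n d X y \<beta>)"
      unfolding full_obj_def l1norm_def matvec_def by (intro continuous_intros continuous_on_product_coordinates)
    then show ?thesis by (auto intro: continuous_on_subset)
  qed
  ultimately obtain b where b: "\<And>\<beta>. \<beta> \<in> PiE UNIV S \<Longrightarrow> full_obj n d X y b \<le> full_obj n d X y \<beta>"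
    using continuous_attains_inf[of "PiE UNIV S" "full_obj n d X y"] by blast
  have "full_obj n d X y b \<le> full_obj n d X y \<beta>" for \<beta>
  proof (cases "full_obj n d X y \<beta> \<le> f0")
    case True
    define \<gamma> where "\<gamma> j = (if j < d then \<beta> j else 0)" for j
    have mv: "matvec d X \<gamma> = matvec d X \<beta>" by (rule ext) (simp add: matvec_def \<gamma>_def)
    have "l1norm n (matvec d X \<beta>) \<le> (\<Sum>i<n. \<bar>matvec d X \<beta> i - y i\<bar> + \<bar>y i\<bar>)"
      unfolding l1norm_def by (intro sum_mono) linarith
    also have "\<dots> \<le> 2 * f0" using True by (simp add: full_obj_def l1norm_def f0_def sum.distrib)
    finally have "\<kappa> * l1norm n (matvec d X \<beta>) \<le> \<kappa> * (2 * f0)" using \<kappa>0 by (rule mult_left_mono)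
    then have bound: "\<bar>\<beta> j\<bar> \<le> \<kappa> * (2 * f0)" if "j < d" for j using \<kappa>[OF that, of \<beta>] by linarith
    have "\<gamma> j \<in> S j" for j
      using bound[of j] by (simp add: \<gamma>_def S_def abs_le_iff) linarith
    then have "full_obj n d X y b \<le> full_obj n d X y \<gamma>" by (intro b) auto
    then show ?thesis by (simp add: full_obj_def mv)
  next
    case False
    then show ?thesis using b[OF Z] zero by linarith
  qed
  then show ?thesis by blast
qed

text \<open>An exponential Markov bound: every bad sample forces \<open>F k \<ge> exp a\<close>,
  while symmetrization and contraction bound the expectation of \<open>F\<close> by the signed
  walk.\<close>

lemma prob_bad_event_le:
  assumes d: "d \<ge> 1" and N: "N > 0" and \<epsilon>: "0 < \<epsilon>" "\<epsilon> < 1"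
  defines "p \<equiv> \<lambda>i. real N * w i / real d"
  shows "(\<Sum>i<n. p i) = real N"
    and "measure_pmf.prob (sampling_pmf n p N) (- good_event n d N X y p \<epsilon>)
       \<le> 2 * real d * exp (- (\<epsilon>\<^sup>2 * real N / (256 * real d)))"
proof -
  have p_pos: "p i > 0" if "i < n" for i using w_pos[OF that] d N by (simp add: p_def)
  then have p0: "p i \<ge> 0" if "i < n" for i using that by (simp add: less_imp_le)
  show sum_p: "(\<Sum>i<n. p i) = real N"
    using d by (simp add: p_def sum_weights flip: sum_distrib_left sum_divide_distrib)
  note props = p0 sum_p N
  define D where "D = sampling_pmf n p N"
  \<comment> \<open>Intersecting with the support makes the set finite and guarantees that the
    sampled indices are below \<open>n\<close>.\<close>
  define Bad where "Bad = set_pmf D - good_event n d N X y p \<epsilon>"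
  have finD: "finite (set_pmf D)" unfolding D_def by (rule set_sampling_pmf[OF props])
  have prob_eq: "measure_pmf.prob D (- good_event n d N X y p \<epsilon>) = measure_pmf.prob D Bad"
    by (rule measure_prob_cong_0) (auto simp: Bad_def set_pmf_eq)
  obtain b where b: "\<And>\<beta>. full_obj n d X y b \<le> full_obj n d X y \<beta>" using full_obj_attains by blast
  obtain z where z: "\<forall>k. (\<forall>r<N. k r < n) \<longrightarrow> k \<notin> good_event n d N X y p \<epsilon> \<longrightarrow>
    (\<exists>u. l1norm n (matvec d X u) \<le> 1 \<and>
      (\<Sum>i<n. \<bar>matvec d X u i - z i\<bar> - \<bar>z i\<bar>) \<ge> \<epsilon> / 4 \<and>
      (\<Sum>r<N. (\<bar>matvec d X u (k r) - z (k r)\<bar> - \<bar>z (k r)\<bar>) / p (k r)) \<le> 0)"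
    using bad_event_witness[of \<epsilon> n p d X y b N, OF \<epsilon> p_pos b] by blast
  define W where "W k u \<longleftrightarrow> l1norm n (matvec d X u) \<le> 1 \<and>
      (\<Sum>i<n. \<bar>matvec d X u i - z i\<bar> - \<bar>z i\<bar>) \<ge> \<epsilon> / 4 \<and>
      (\<Sum>r<N. (\<bar>matvec d X u (k r) - z (k r)\<bar> - \<bar>z (k r)\<bar>) / p (k r)) \<le> 0" for k u
  have "\<forall>k\<in>Bad. \<exists>u. W k u"
    using z set_sampling_pmf(2)[OF props] by (auto simp: Bad_def D_def W_def)
  then obtain U where "\<And>k. k \<in> Bad \<Longrightarrow> W k (U k)" by metis
  then have U: "\<And>k. k \<in> Bad \<Longrightarrow> l1norm n (matvec d X (U k)) \<le> 1"
      "\<And>k. k \<in> Bad \<Longrightarrow> (\<Sum>i<n. \<bar>matvec d X (U k) i - z i\<bar> - \<bar>z i\<bar>) \<ge> \<epsilon> / 4"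
      "\<And>k. k \<in> Bad \<Longrightarrow> (\<Sum>r<N. (\<bar>matvec d X (U k) (k r) - z (k r)\<bar> - \<bar>z (k r)\<bar>) / p (k r)) \<le> 0"
    by (simp_all add: W_def)
  show "measure_pmf.prob (sampling_pmf n p N) (- good_event n d N X y p \<epsilon>)
       \<le> 2 * real d * exp (- (\<epsilon>\<^sup>2 * real N / (256 * real d)))"
  proof (cases "Bad = {}")
    case True
    then show ?thesis using prob_eq by (simp add: D_def)
  next
    case False
    define T where "T = U ` Bad"
    have T: "finite T" "T \<noteq> {}" "\<And>u. u \<in> T \<Longrightarrow> l1norm n (matvec d X u) \<le> 1"
      using False finD U(1) by (auto simp: T_def Bad_def)
    \<comment> \<open>This value minimizes the final exponent
      \<open>4 * s\<^sup>2 - s * \<epsilon> / 4\<close> (times \<open>real N / real d\<close>); the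
      minimum is \<open>- \<epsilon>\<^sup>2 / 256\<close>.\<close>
    define s where "s = \<epsilon> / 32"
    define q where "q = (\<lambda>i. w i / real d)"
    define t where "t = (\<lambda>i u. s / w i * matvec d X u i)"
    define \<psi> where "\<psi> = (\<lambda>i u. s / w i * (\<bar>matvec d X u i - z i\<bar> - \<bar>z i\<bar>))"
    define \<xi> where "\<xi> = (\<lambda>i u. (\<Sum>j<n. q j * \<psi> j u) - \<psi> i u)"
    \<comment> \<open>At a witness the mean of \<open>\<psi>\<close> under \<open>q\<close> is at
      least \<open>s / real d * (\<epsilon> / 4)\<close>, while its sampled sum is at most 0. The
      \<open>N\<close> centered increments therefore add up to at least \<open>a\<close>.\<close>
    define a where "a = real N * s / real d * (\<epsilon> / 4)"
    define F where "F k = exp_max T (\<lambda>u. 0 + (\<Sum>r<N. \<xi> (k r) u))" for k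
    have large: "exp a \<le> F k" if k: "k \<in> Bad" for k
    proof -
      let ?\<phi> = "\<lambda>i. \<bar>matvec d X (U k) i - z i\<bar> - \<bar>z i\<bar>"
      have kn: "k r < n" if "r < N" for r
        using k that set_sampling_pmf(2)[OF props] by (auto simp: Bad_def D_def)
      have "q j * \<psi> j (U k) = s / real d * ?\<phi> j" if "j < n" for j
        using w_pos[OF that] by (simp add: q_def \<psi>_def)
      then have "(\<Sum>j<n. q j * \<psi> j (U k)) = s / real d * (\<Sum>j<n. ?\<phi> j)"
        by (simp add: sum_distrib_left)
      also have "\<dots> \<ge> s / real d * (\<epsilon> / 4)"
        using U(2)[OF k] \<epsilon> by (intro mult_left_mono) (auto simp: s_def)
      finally have "real N * (s / real d * (\<epsilon> / 4)) \<le> real N * (\<Sum>j<n. q j * \<psi> j (U k))"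
        by (intro mult_left_mono) auto
      moreover have "\<psi> (k r) (U k) = s * real N / real d * (?\<phi> (k r) / p (k r))" if "r < N" for r
        using w_pos[OF kn[OF that]] N d by (simp add: p_def \<psi>_def)
      then have "(\<Sum>r<N. \<psi> (k r) (U k)) = s * real N / real d * (\<Sum>r<N. ?\<phi> (k r) / p (k r))"
        by (simp add: sum_distrib_left)
      moreover have "\<dots> \<le> 0" using U(3)[OF k] \<epsilon> by (intro mult_nonneg_nonpos) (auto simp: s_def)
      ultimately have "a \<le> (\<Sum>r<N. \<xi> (k r) (U k))"
        by (simp add: \<xi>_def sum_subtractf a_def)
      then have "exp a \<le> exp (0 + (\<Sum>r<N. \<xi> (k r) (U k)))" by simp
      also have "\<dots> \<le> F k"
        unfolding F_def using T(1) k by (intro exp_le_exp_max[where h = "\<lambda>u. 0 + (\<Sum>r<N. \<xi> (k r) u)"]) (auto simp: T_def)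
      finally show ?thesis .
    qed
    have "exp a * measure_pmf.prob D Bad = measure_pmf.expectation D (\<lambda>k. exp a * indicator Bad k)"
      by simp
    also have "\<dots> \<le> measure_pmf.expectation D F"
    proof (rule integral_mono)
      show "exp a * indicator Bad k \<le> F k" for k
        using large[of k] exp_max_pos[THEN less_imp_le] by (auto simp: indicator_def F_def)
    qed (auto intro: integrable_measure_pmf_finite[OF finD])
    also have "\<dots> = walk T n (pmf (row_pmf n p N)) \<xi> N (\<lambda>u. 0)"
      unfolding D_def F_def sampling_pmf_def by (rule expectation_exp_max_sum[OF set_row_pmf[OF props]])
    also have "\<dots> = walk T n q \<xi> N (\<lambda>u. 0)"
    proof -
      have "pmf (row_pmf n p N) i = q i" if "i < n" for i
        using that N d by (subst pmf_row_pmf[OF props]) (simp_all add: q_def p_def)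
      then have "walk T n (pmf (row_pmf n p N)) \<xi> r h = walk T n q \<xi> r h" for r h
        by (induction r arbitrary: h) auto
      then show ?thesis .
    qed
    also have "\<dots> \<le> signed_walk T n q t N (\<lambda>u. 0)"
    proof (rule walk_le_signed_walk[OF T(1,2)])
      show "q i \<ge> 0" if "i < n" for i using w_pos[OF that] by (simp add: q_def)
      show "(\<Sum>i<n. q i) = 1" using sum_weights d by (simp add: q_def flip: sum_divide_distrib)
      fix i b c assume i: "i < n"
      have sw: "s / w i \<ge> 0" using \<epsilon> w_pos[OF i] by (simp add: s_def)
      have "\<bar>\<psi> i b - \<psi> i c\<bar> = s / w i * \<bar>\<bar>matvec d X b i - z i\<bar> - \<bar>matvec d X c i - z i\<bar>\<bar>"
      proof -
        have "\<psi> i b - \<psi> i c = s / w i * (\<bar>matvec d X b i - z i\<bar> - \<bar>matvec d X c i - z i\<bar>)"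
          unfolding \<psi>_def right_diff_distrib[symmetric] by simp
        then show ?thesis by (simp only: abs_mult abs_of_nonneg[OF sw])
      qed
      also have "\<dots> \<le> s / w i * \<bar>matvec d X b i - matvec d X c i\<bar>"
        using sw by (intro mult_left_mono) linarith+
      also have "\<dots> = \<bar>t i b - t i c\<bar>"
        by (simp only: t_def abs_mult abs_of_nonneg[OF sw] right_diff_distrib[symmetric])
      finally show "\<bar>\<psi> i b - \<psi> i c\<bar> \<le> \<bar>t i b - t i c\<bar>" .
      have "\<bar>\<psi> i b\<bar> = s / w i * \<bar>\<bar>matvec d X b i - z i\<bar> - \<bar>z i\<bar>\<bar>"
        by (simp only: \<psi>_def abs_mult abs_of_nonneg[OF sw])
      also have "\<dots> \<le> s / w i * \<bar>matvec d X b i\<bar>"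
        using sw by (intro mult_left_mono) linarith+
      also have "\<dots> = \<bar>t i b\<bar>" by (simp only: t_def abs_mult abs_of_nonneg[OF sw])
      finally show "\<bar>\<psi> i b\<bar> \<le> \<bar>t i b\<bar>" .
    qed (simp add: \<xi>_def)
    also have "\<dots> \<le> 2 * real d * exp (4 * s\<^sup>2 / real d * real N)"
      unfolding q_def t_def using \<epsilon> by (intro signed_walk_lewis_le[OF T d]) (auto simp: s_def)
    finally have "measure_pmf.prob D Bad \<le> 2 * real d * exp (4 * s\<^sup>2 / real d * real N) / exp a"
      by (simp add: pos_le_divide_eq mult.commute)
    also have "\<dots> = 2 * real d * exp (4 * s\<^sup>2 / real d * real N - a)" by (simp add: exp_diff)
    also have "4 * s\<^sup>2 / real d * real N - a = - (\<epsilon>\<^sup>2 * real N / (256 * real d))"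
      using d by (simp add: s_def a_def power2_eq_square field_simps)
    finally show ?thesis using prob_eq by (simp add: D_def)
  qed
qed

end

subsection \<open>Few samples in dimension one\<close>

text \<open>Let \<open>z j\<close> be the bad point closest to \<open>m\<close>, at distance
  \<open>h\<close>. If the bad mass exceeded 3/8, then moving from \<open>m\<close> to
  \<open>z j\<close> would cost at most \<open>h * (1 - 2 * (3 / 8)) = h / 4\<close>, while
  \<open>f m \<ge> 3 / 8 * h\<close>. The relative increase would be at most 2/3, contradicting
  badness.\<close>

lemma one_sided_bad_mass_le:
  fixes z w :: "nat \<Rightarrow> real" and m :: real
  assumes w: "\<And>i. i < n \<Longrightarrow> w i \<ge> 0" "(\<Sum>i<n. w i) = 1" and \<epsilon>: "\<epsilon> \<ge> 2 / 3"
  defines "f \<equiv> \<lambda>s. \<Sum>i<n. w i * \<bar>s - z i\<bar>"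
  defines "A \<equiv> {i. i < n \<and> z i > m \<and> f (z i) > (1 + \<epsilon>) * f m}"
  shows "sum w A \<le> 3 / 8"
proof (rule ccontr)
  assume "\<not> ?thesis"
  then have big: "sum w A > 3 / 8" by simp
  have finA: "finite A" and subA: "A \<subseteq> {..<n}" by (auto simp: A_def)
  have "A \<noteq> {}" using big by auto
  then obtain j where j: "j \<in> A" "\<And>i. i \<in> A \<Longrightarrow> z j \<le> z i"
    using arg_min_if_finite[OF finA, of z] arg_min_least[OF finA, of _ z] by metis
  define h where "h = z j - m"
  have h: "h > 0" using j(1) by (simp add: A_def h_def)
  have split: "(\<Sum>i<n. g i) = sum g A + sum g ({..<n} - A)" for g :: "nat \<Rightarrow> real"
    using subA by (simp add: sum.subset_diff add.commute)
  have "f (z j) - f m = (\<Sum>i<n. w i * (\<bar>z j - z i\<bar> - \<bar>m - z i\<bar>))"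
    by (simp add: f_def algebra_simps sum_subtractf)
  also have "\<dots> \<le> (\<Sum>i\<in>A. w i * (- h)) + (\<Sum>i\<in>{..<n} - A. w i * h)"
    unfolding split
  proof (intro add_mono sum_mono mult_left_mono)
    fix i assume "i \<in> A"
    then have "z j \<le> z i" "m < z i" by (auto simp: j A_def)
    then show "\<bar>z j - z i\<bar> - \<bar>m - z i\<bar> \<le> - h" by (simp add: h_def)
  next
    fix i
    show "\<bar>z j - z i\<bar> - \<bar>m - z i\<bar> \<le> h" using h by (simp add: h_def)
  qed (use w subA in auto)
  also have "\<dots> = h * (sum w ({..<n} - A) - sum w A)"
    by (simp add: algebra_simps sum_negf flip: sum_distrib_left sum_distrib_right)
  also have "\<dots> = h * (1 - 2 * sum w A)" using split[of w] w by simp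
  also have "\<dots> \<le> h * (1 / 4)" using h big by (intro mult_left_mono) auto
  finally have up: "f (z j) - f m \<le> h / 4" by simp
  have "3 / 8 * h \<le> sum w A * h" using big h by simp
  also have "\<dots> \<le> (\<Sum>i\<in>A. w i * \<bar>m - z i\<bar>)"
    unfolding sum_distrib_right
  proof (intro sum_mono mult_left_mono)
    fix i assume "i \<in> A"
    then show "h \<le> \<bar>m - z i\<bar>" using j(2)[of i] by (simp add: h_def)
  qed (use w subA in auto)
  also have "\<dots> \<le> f m"
    unfolding f_def using w subA by (intro sum_mono2) auto
  finally have fm: "3 / 8 * h \<le> f m" .
  have "f (z j) - f m > \<epsilon> * f m" using j(1) by (simp add: A_def algebra_simps)
  moreover have "\<epsilon> * f m \<ge> 2 / 3 * f m" using \<epsilon> fm h by (intro mult_right_mono) auto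
  ultimately show False using up fm by linarith
qed

text \<open>Reflection gives the same bound 3/8 for bad points on the left of \<open>m\<close>, and
  points at \<open>m\<close> are good, so mass at least \<open>1 - 2 * (3 / 8)\<close>
  remains.\<close>

lemma good_mass_ge:
  fixes z w :: "nat \<Rightarrow> real" and m :: real
  assumes w: "\<And>i. i < n \<Longrightarrow> w i \<ge> 0" "(\<Sum>i<n. w i) = 1" and \<epsilon>: "\<epsilon> \<ge> 2 / 3"
  defines "f \<equiv> \<lambda>s. \<Sum>i<n. w i * \<bar>s - z i\<bar>"
  shows "sum w {i. i < n \<and> f (z i) \<le> (1 + \<epsilon>) * f m} \<ge> 1 / 4"
proof -
  define G where "G = {i. i < n \<and> f (z i) \<le> (1 + \<epsilon>) * f m}"
  define R where "R = {i. i < n \<and> z i > m \<and> f (z i) > (1 + \<epsilon>) * f m}"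
  define L where "L = {i. i < n \<and> - z i > - m \<and> f (z i) > (1 + \<epsilon>) * f m}"
  have "sum w R \<le> 3 / 8"
    unfolding R_def f_def using one_sided_bad_mass_le[OF w \<epsilon>, where z = z and m = m] by simp
  moreover have "(\<Sum>i<n. w i * \<bar>- s - - z i\<bar>) = f s" for s
    unfolding f_def by (intro sum.cong refl) (simp add: abs_minus_commute)
  then have "sum w L \<le> 3 / 8"
    unfolding L_def using one_sided_bad_mass_le[OF w \<epsilon>, where z = "\<lambda>i. - z i" and m = "- m"] by simp
  moreover have "f m \<ge> 0" unfolding f_def using w by (intro sum_nonneg) auto
  then have "f m \<le> (1 + \<epsilon>) * f m" using \<epsilon> by (simp add: mult_le_cancel_right1)
  then have "{..<n} \<subseteq> G \<union> (R \<union> L)"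
    by (auto simp: G_def R_def L_def not_le) (metis linorder_neqE_linordered_idom not_le)
  then have "1 \<le> sum w (G \<union> (R \<union> L))"
    unfolding w(2)[symmetric] using w by (intro sum_mono2) (auto simp: G_def R_def L_def)
  moreover have "sum w (G \<union> (R \<union> L)) \<le> sum w G + sum w (R \<union> L)"
    using w by (subst sum_Un) (auto simp: G_def R_def L_def intro!: sum_nonneg)
  moreover have "sum w (R \<union> L) \<le> sum w R + sum w L"
    using w by (subst sum_Un) (auto simp: R_def L_def intro!: sum_nonneg)
  ultimately show ?thesis by (simp add: G_def)
qed

lemma weighted_abs_sum_between_le:
  fixes z w :: "nat \<Rightarrow> real"
  assumes w: "\<And>i. i < n \<Longrightarrow> w i \<ge> 0" and s: "a \<le> s" "s \<le> b"
    and "(\<Sum>i<n. w i * \<bar>a - z i\<bar>) \<le> c" "(\<Sum>i<n. w i * \<bar>b - z i\<bar>) \<le> c"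
  shows "(\<Sum>i<n. w i * \<bar>s - z i\<bar>) \<le> c"
proof (cases "a = b")
  case True
  then show ?thesis using assms by simp
next
  case False
  define \<tau> where "\<tau> = (s - a) / (b - a)"
  have \<tau>: "0 \<le> \<tau>" "\<tau> \<le> 1" using s False by (auto simp: \<tau>_def)
  have "\<tau> * (b - a) = s - a" using False by (simp add: \<tau>_def)
  then have seq: "s = (1 - \<tau>) * a + \<tau> * b" by (simp add: algebra_simps)
  have "(\<Sum>i<n. w i * \<bar>s - z i\<bar>) \<le> (\<Sum>i<n. w i * ((1 - \<tau>) * \<bar>a - z i\<bar> + \<tau> * \<bar>b - z i\<bar>))"
  proof (intro sum_mono mult_left_mono)
    fix i
    have "s - z i = (1 - \<tau>) * (a - z i) + \<tau> * (b - z i)" unfolding seq by (simp add: algebra_simps)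
    then have "\<bar>s - z i\<bar> \<le> \<bar>(1 - \<tau>) * (a - z i)\<bar> + \<bar>\<tau> * (b - z i)\<bar>" by (metis abs_triangle_ineq)
    then show "\<bar>s - z i\<bar> \<le> (1 - \<tau>) * \<bar>a - z i\<bar> + \<tau> * \<bar>b - z i\<bar>" using \<tau> by (simp add: abs_mult)
  qed (use w in auto)
  also have "\<dots> = (1 - \<tau>) * (\<Sum>i<n. w i * \<bar>a - z i\<bar>) + \<tau> * (\<Sum>i<n. w i * \<bar>b - z i\<bar>)"
    by (simp add: sum_distrib_left sum.distrib algebra_simps sum_subtractf)
  also have "\<dots> \<le> (1 - \<tau>) * c + \<tau> * c"
    using assms \<tau> by (intro add_mono mult_left_mono) auto
  finally show ?thesis by (simp add: algebra_simps)
qed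

text \<open>If \<open>s\<close> lay strictly outside the range of the \<open>z r\<close>, moving it
  to the nearest end of the range would decrease every term.\<close>

lemma minimizer_between:
  fixes c z :: "nat \<Rightarrow> real"
  assumes N: "N > 0" and c: "\<And>r. r < N \<Longrightarrow> c r > 0"
    and min: "\<And>s'. (\<Sum>r<N. c r * \<bar>s - z r\<bar>) \<le> (\<Sum>r<N. c r * \<bar>s' - z r\<bar>)"
  shows "\<exists>r<N. z r \<le> s" "\<exists>r<N. s \<le> z r"
proof -
  have fin: "finite (z ` {..<N})" "z ` {..<N} \<noteq> {}" using N by auto
  show "\<exists>r<N. z r \<le> s"
  proof (rule ccontr)
    assume *: "\<not> ?thesis"
    define a where "a = Min (z ` {..<N})"
    have a: "a \<le> z r" if "r < N" for r using that by (simp add: a_def)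
    have "a \<in> z ` {..<N}" unfolding a_def by (rule Min_in[OF fin])
    then have "s < a" using * by (auto simp: not_le)
    have "(\<Sum>r<N. c r * \<bar>a - z r\<bar>) < (\<Sum>r<N. c r * \<bar>s - z r\<bar>)"
    proof (rule sum_strict_mono)
      fix r assume "r \<in> {..<N}"
      then show "c r * \<bar>a - z r\<bar> < c r * \<bar>s - z r\<bar>" using c[of r] a[of r] \<open>s < a\<close> by simp
    qed (use N in auto)
    then show False using min[of a] by simp
  qed
  show "\<exists>r<N. s \<le> z r"
  proof (rule ccontr)
    assume *: "\<not> ?thesis"
    define a where "a = Max (z ` {..<N})"
    have a: "z r \<le> a" if "r < N" for r using that by (simp add: a_def)
    have "a \<in> z ` {..<N}" unfolding a_def by (rule Max_in[OF fin])
    then have "a < s" using * by (auto simp: not_le)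
    have "(\<Sum>r<N. c r * \<bar>a - z r\<bar>) < (\<Sum>r<N. c r * \<bar>s - z r\<bar>)"
    proof (rule sum_strict_mono)
      fix r assume "r \<in> {..<N}"
      then show "c r * \<bar>a - z r\<bar> < c r * \<bar>s - z r\<bar>" using c[of r] a[of r] \<open>a < s\<close> by simp
    qed (use N in auto)
    then show False using min[of a] by simp
  qed
qed

text \<open>In dimension one \<open>w i\<close> is proportional to \<open>\<bar>X i 0\<bar>\<close>,
  so both objectives are weighted sums of distances to the ratios \<open>z i\<close>. If all samples
  fall into \<open>G\<close>, the sketched minimizer lies between two sampled ratios and is good by
  convexity of \<open>f\<close>; each sample does so with probability at least 1/4.\<close>

lemma (in lewis_design) prob_good_event_dim_one_ge:
  assumes d: "d = 1" and N: "N > 0" and \<epsilon>: "2 / 3 \<le> \<epsilon>"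
  defines "p \<equiv> \<lambda>i. real N * w i / real d"
  shows "measure_pmf.prob (sampling_pmf n p N) (good_event n d N X y p \<epsilon>) \<ge> (1 / 4) ^ N"
proof -
  have w0: "w i \<ge> 0" if "i < n" for i using w_pos[OF that] by simp
  have sumw: "(\<Sum>i<n. w i) = 1" using sum_weights d by simp
  have p_pos: "p i > 0" if "i < n" for i using w_pos[OF that] d N by (simp add: p_def)
  then have p0: "p i \<ge> 0" if "i < n" for i using that by (simp add: less_imp_le)
  have sum_p: "(\<Sum>i<n. p i) = real N" using d by (simp add: p_def sumw flip: sum_distrib_left)
  note props = p0 sum_p N
  define x where "x i = X i 0" for i
  define \<kappa> where "\<kappa> = sqrt (B 0 0)"
  have wx: "(w i)\<^sup>2 = (x i)\<^sup>2 * B 0 0" if "i < n" for i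
    using w_square[OF that] d by (simp add: x_def power2_eq_square)
  have x0: "x i \<noteq> 0" if "i < n" for i using wx[OF that] w_pos[OF that] by auto
  have w_eq: "w i = \<kappa> * \<bar>x i\<bar>" if "i < n" for i
  proof -
    have "w i = sqrt ((w i)\<^sup>2)" using w0[OF that] by simp
    also have "\<dots> = \<kappa> * \<bar>x i\<bar>" unfolding wx[OF that] by (simp add: real_sqrt_mult \<kappa>_def)
    finally show ?thesis .
  qed
  have "n > 0" using sumw by (cases n) auto
  then have \<kappa>: "\<kappa> > 0" using w_eq[of 0] w_pos[of 0] by (auto simp: zero_less_mult_iff)
  define z where "z i = y i / x i" for i
  define f where "f = (\<lambda>s. \<Sum>i<n. w i * \<bar>s - z i\<bar>)"
  have term_eq: "\<bar>matvec d X \<beta> i - y i\<bar> = w i / \<kappa> * \<bar>\<beta> 0 - z i\<bar>" if "i < n" for \<beta> i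
  proof -
    have "matvec d X \<beta> i - y i = x i * (\<beta> 0 - z i)"
      using d x0[OF that] by (simp add: matvec_def x_def z_def right_diff_distrib)
    then show ?thesis using w_eq[OF that] \<kappa> by (simp add: abs_mult)
  qed
  have full: "full_obj n d X y \<beta> = f (\<beta> 0) / \<kappa>" for \<beta>
    by (simp add: full_obj_def l1norm_def term_eq f_def sum_divide_distrib)
  obtain b where b: "\<And>\<beta>. full_obj n d X y b \<le> full_obj n d X y \<beta>" using full_obj_attains by blast
  define G where "G = {i. i < n \<and> f (z i) \<le> (1 + \<epsilon>) * f (b 0)}"
  have "Pi {..<N} (\<lambda>_. G) \<subseteq> good_event n d N X y p \<epsilon>"
  proof
    fix k assume k: "k \<in> Pi {..<N} (\<lambda>_. G)"
    then have kn: "k r < n" if "r < N" for r using that by (auto simp: G_def)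
    have kG: "f (z (k r)) \<le> (1 + \<epsilon>) * f (b 0)" if "r < N" for r using k that by (auto simp: G_def)
    have "full_obj n d X y \<beta> \<le> (1 + \<epsilon>) * (INF \<beta>. full_obj n d X y \<beta>)"
      if min: "is_arg_min (sketched_obj n d N X y p k) (\<lambda>_. True) \<beta>" for \<beta>
    proof -
      define c where "c r = w (k r) / \<kappa> / p (k r)" for r
      have sk: "sketched_obj n d N X y p k \<gamma> = (\<Sum>r<N. c r * \<bar>\<gamma> 0 - z (k r)\<bar>)" for \<gamma>
        by (subst sketched_obj_eq[OF kn p0]) (auto simp: term_eq kn c_def)
      have c: "c r > 0" if "r < N" for r
        using w_pos[OF kn[OF that]] p_pos[OF kn[OF that]] \<kappa> by (simp add: c_def)
      have "sketched_obj n d N X y p k \<beta> \<le> sketched_obj n d N X y p k (\<lambda>_. s')" for s'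
        using min by (auto simp: is_arg_min_def not_less)
      then have "(\<Sum>r<N. c r * \<bar>\<beta> 0 - z (k r)\<bar>) \<le> (\<Sum>r<N. c r * \<bar>s' - z (k r)\<bar>)" for s'
        unfolding sk .
      from minimizer_between[OF N c this]
      obtain r r' where "r < N" "z (k r) \<le> \<beta> 0" "r' < N" "\<beta> 0 \<le> z (k r')" by blast
      then have "f (\<beta> 0) \<le> (1 + \<epsilon>) * f (b 0)"
        using weighted_abs_sum_between_le[OF w0, where a = "z (k r)" and s = "\<beta> 0" and b = "z (k r')" and z = z] kG
        by (simp add: f_def)
      then have "f (\<beta> 0) / \<kappa> \<le> (1 + \<epsilon>) * f (b 0) / \<kappa>" using \<kappa> by (intro divide_right_mono) auto
      then show ?thesis
        unfolding INF_full_obj_eq[OF b] full[of \<beta>] full[of b] by simp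
    qed
    then show "k \<in> good_event n d N X y p \<epsilon>" by (simp add: good_event_def)
  qed
  then have "measure_pmf.prob (sampling_pmf n p N) (Pi {..<N} (\<lambda>_. G))
      \<le> measure_pmf.prob (sampling_pmf n p N) (good_event n d N X y p \<epsilon>)"
    by (intro measure_pmf.finite_measure_mono) auto
  moreover have "measure_pmf.prob (sampling_pmf n p N) (Pi {..<N} (\<lambda>_. G))
      = measure_pmf.prob (row_pmf n p N) G ^ N"
    by (simp add: sampling_pmf_def measure_Pi_pmf_Pi)
  moreover have "pmf (row_pmf n p N) i = w i" if "i < n" for i
    using that N d by (subst pmf_row_pmf[OF props]) (simp_all add: p_def)
  then have "measure_pmf.prob (row_pmf n p N) G = sum w G"
    by (subst measure_measure_pmf_finite) (auto simp: G_def intro!: sum.cong)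
  moreover have "1 / 4 \<le> sum w G"
    unfolding G_def f_def by (rule good_mass_ge[OF w0 sumw \<epsilon>])
  then have "(1 / 4) ^ N \<le> sum w G ^ N" by (intro power_mono) auto
  ultimately show ?thesis by simp
qed

text \<open>Both claims reduce to this statement. Under the first alternative the tail bound is at
  most \<open>\<delta>\<close>; the second covers few samples in dimension one. The same
  \<open>p\<close> serves both.\<close>

lemma lewis_sampling:
  assumes lw: "lewis_weights n d X w" and d: "d \<ge> 1" and N: "N > 0"
    and \<epsilon>: "0 < \<epsilon>" "\<epsilon> < 1" and \<delta>: "0 < \<delta>"
    and large: "real N \<ge> 256 * (real d / \<epsilon>\<^sup>2) * ln (2 * real d / \<delta>) \<or>
      d = 1 \<and> 2 / 3 \<le> \<epsilon> \<and> 1 - \<delta> \<le> (1 / 4) ^ N"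
  shows "\<exists>p. (\<forall>i<n. p i \<ge> 0) \<and> (\<Sum>i<n. p i) = real N \<and>
    (\<forall>y. measure_pmf.prob (sampling_pmf n p N) (good_event n d N X y p \<epsilon>) \<ge> 1 - \<delta>)"
proof -
  obtain B where "lewis_design n d X w B"
    using lw by (auto simp: lewis_weights_def lewis_design_def)
  then interpret lewis_design n d X w B .
  define p where "p = (\<lambda>i. real N * w i / real d)"
  have "1 - \<delta> \<le> measure_pmf.prob (sampling_pmf n p N) (good_event n d N X y p \<epsilon>)" for y
    using large
  proof
    assume "real N \<ge> 256 * (real d / \<epsilon>\<^sup>2) * ln (2 * real d / \<delta>)"
    then have "\<epsilon>\<^sup>2 * real N / (256 * real d) \<ge> ln (2 * real d / \<delta>)"
      using \<epsilon> d by (simp add: field_simps)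
    then have "exp (- (\<epsilon>\<^sup>2 * real N / (256 * real d))) \<le> exp (- ln (2 * real d / \<delta>))" by simp
    also have "\<dots> = \<delta> / (2 * real d)" using d \<delta> by (simp add: exp_minus)
    finally have "2 * real d * exp (- (\<epsilon>\<^sup>2 * real N / (256 * real d))) \<le> 2 * real d * (\<delta> / (2 * real d))"
      by (intro mult_left_mono) auto
    also have "\<dots> = \<delta>" using d by simp
    finally have "measure_pmf.prob (sampling_pmf n p N) (- good_event n d N X y p \<epsilon>) \<le> \<delta>"
      using prob_bad_event_le(2)[OF d N \<epsilon>, of y] by (simp add: p_def)
    then show ?thesis
      using measure_pmf.prob_compl[of "good_event n d N X y p \<epsilon>" "sampling_pmf n p N"]
      by (simp add: Compl_eq_Diff_UNIV)
  next
    assume "d = 1 \<and> 2 / 3 \<le> \<epsilon> \<and> 1 - \<delta> \<le> (1 / 4) ^ N"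
    then show ?thesis
      using prob_good_event_dim_one_ge[OF _ N, of \<epsilon> y] unfolding p_def by linarith
  qed
  moreover have "(\<Sum>i<n. p i) = real N" unfolding p_def by (rule prob_bad_event_le(1)[OF d N \<epsilon>])
  moreover have "\<forall>i<n. p i \<ge> 0" using w_pos by (simp add: p_def less_imp_le)
  ultimately show ?thesis by blast
qed

subsection \<open>Sample complexity\<close>

theorem theorem4:
  shows "(\<exists>C>0. \<forall>n d X w \<epsilon> \<delta> (N::nat).
            d \<ge> 1 \<longrightarrow> full_col_rank n d X \<longrightarrow> lewis_weights n d X w \<longrightarrow>
            0 < \<epsilon> \<longrightarrow> \<epsilon> < 1 \<longrightarrow> 0 < \<delta> \<longrightarrow> \<delta> < 1 \<longrightarrow>
            real N \<ge> C * (real d / \<epsilon>\<^sup>2) * ln (real d / (\<epsilon> * \<delta>)) \<longrightarrow>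
            (\<exists>p. (\<forall>i<n. p i \<ge> 0) \<and> (\<Sum>i<n. p i) = real N \<and>
               (\<forall>y. measure_pmf.prob (sampling_pmf n p N) (good_event n d N X y p \<epsilon>) \<ge> 1 - \<delta>)))
       \<and> (\<forall>\<delta>::real. 0 < \<delta> \<longrightarrow> \<delta> < 1 \<longrightarrow>
          (\<exists>C'>0. \<forall>n d X w \<epsilon> (N::nat).
            d \<ge> 2 \<longrightarrow> full_col_rank n d X \<longrightarrow> lewis_weights n d X w \<longrightarrow>
            0 < \<epsilon> \<longrightarrow> \<epsilon> < 1 \<longrightarrow>
            real N \<ge> C' * (1 / \<epsilon>\<^sup>2) * real d * ln (real d) \<longrightarrow>
            (\<exists>p. (\<forall>i<n. p i \<ge> 0) \<and> (\<Sum>i<n. p i) = real N \<and>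
               (\<forall>y. measure_pmf.prob (sampling_pmf n p N) (good_event n d N X y p \<epsilon>) \<ge> 1 - \<delta>))))"
proof (intro conjI allI impI)
  \<comment> \<open>For \<open>d = 1\<close> and \<open>\<epsilon>\<close>, \<open>\<delta>\<close>
    above 1/2, \<open>256 * 4 * 2 = 2048\<close> samples suffice for the tail bound. The factor
    \<open>4 ^ M\<close> in \<open>C\<close> makes any smaller admissible \<open>N\<close> force
    \<open>\<epsilon> * \<delta>\<close> to within \<open>1 / 4 ^ M\<close> of 1.\<close>
  define M :: nat where "M = 2048"
  define C :: real where "C = real M * 4 ^ M"
  have pow4: "(1::real) \<le> 4 ^ M" by simp
  then have C: "C \<ge> 2048" "C > 0" unfolding C_def by (auto simp: M_def intro!: mult_left_mono[of 1, simplified])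
  show "\<exists>C>0. \<forall>n d X w \<epsilon> \<delta> (N::nat).
            d \<ge> 1 \<longrightarrow> full_col_rank n d X \<longrightarrow> lewis_weights n d X w \<longrightarrow>
            0 < \<epsilon> \<longrightarrow> \<epsilon> < 1 \<longrightarrow> 0 < \<delta> \<longrightarrow> \<delta> < 1 \<longrightarrow>
            real N \<ge> C * (real d / \<epsilon>\<^sup>2) * ln (real d / (\<epsilon> * \<delta>)) \<longrightarrow>
            (\<exists>p. (\<forall>i<n. p i \<ge> 0) \<and> (\<Sum>i<n. p i) = real N \<and>
               (\<forall>y. measure_pmf.prob (sampling_pmf n p N) (good_event n d N X y p \<epsilon>) \<ge> 1 - \<delta>))"
  proof (rule exI[of _ C], intro conjI allI impI)
    fix n d N :: nat and X :: "nat \<Rightarrow> nat \<Rightarrow> real" and w :: "nat \<Rightarrow> real" and \<epsilon> \<delta> :: real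
    assume d: "1 \<le> d" and lw: "lewis_weights n d X w" and \<epsilon>: "0 < \<epsilon>" "\<epsilon> < 1" and \<delta>: "0 < \<delta>" "\<delta> < 1"
      and Nge: "C * (real d / \<epsilon>\<^sup>2) * ln (real d / (\<epsilon> * \<delta>)) \<le> real N"
    define L where "L = ln (real d / (\<epsilon> * \<delta>))"
    have \<epsilon>\<delta>: "0 < \<epsilon> * \<delta>" "\<epsilon> * \<delta> < 1" "\<epsilon> * \<delta> \<le> \<epsilon>" "\<epsilon> * \<delta> \<le> \<delta>"
      using \<epsilon> \<delta> mult_strict_mono[of \<epsilon> 1 \<delta> 1] by (auto simp: mult_left_le mult_left_le_one_le)
    have "1 < real d / (\<epsilon> * \<delta>)" using \<epsilon>\<delta> d by (simp add: less_divide_eq)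
    then have L: "L > 0" unfolding L_def by simp
    have "C * (real d / \<epsilon>\<^sup>2) * L > 0" using C L d \<epsilon> by simp
    then have N: "N > 0" using Nge by (cases N) (auto simp: L_def)
    have "real N \<ge> 256 * (real d / \<epsilon>\<^sup>2) * ln (2 * real d / \<delta>) \<or>
      d = 1 \<and> 2 / 3 \<le> \<epsilon> \<and> 1 - \<delta> \<le> (1 / 4) ^ N"
    proof (cases "real d / (\<epsilon> * \<delta>) \<ge> 2")
      \<comment> \<open>Here \<open>L \<ge> ln 2\<close>, so the factor 2 inside the logarithm is
        absorbed: \<open>ln (2 * real d / \<delta>) \<le> 2 * L\<close>.\<close>
      case True
      then have "ln 2 \<le> L" unfolding L_def by simp
      moreover have "real d / \<delta> \<le> real d / (\<epsilon> * \<delta>)" using \<epsilon>\<delta> d by (intro divide_left_mono) (auto simp: \<delta>)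
      then have "ln (real d / \<delta>) \<le> L" unfolding L_def using d \<delta> by (intro ln_mono) auto
      moreover have "ln (2 * real d / \<delta>) = ln 2 + ln (real d / \<delta>)"
        using d \<delta> ln_mult[of 2 "real d / \<delta>"] by simp
      ultimately have "ln (2 * real d / \<delta>) \<le> 2 * L" by simp
      then have "256 * (real d / \<epsilon>\<^sup>2) * ln (2 * real d / \<delta>) \<le> 256 * (real d / \<epsilon>\<^sup>2) * (2 * L)"
        by (intro mult_left_mono) auto
      also have "\<dots> = 512 * ((real d / \<epsilon>\<^sup>2) * L)" by simp
      also have "\<dots> \<le> C * ((real d / \<epsilon>\<^sup>2) * L)" using C L by (intro mult_right_mono) auto
      also have "\<dots> \<le> real N" using Nge by (simp add: L_def mult.assoc)
      finally show ?thesis by simp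
    next
      case False
      then have lt: "real d < 2 * (\<epsilon> * \<delta>)" using \<epsilon>\<delta> by (simp add: not_le divide_less_eq)
      then have "real d < 2" using \<epsilon>\<delta> by linarith
      then have d1: "d = 1" using d by simp
      then have half: "1 / 2 < \<epsilon>" "1 / 2 < \<delta>" using lt \<epsilon>\<delta> by auto
      show ?thesis
      proof (cases "N < M")
        case False
        have "ln (2 * real d / \<delta>) \<le> ln (2 * 2)"
          using half \<delta> d1 by (simp add: divide_le_eq)
        also have "\<dots> = 2 * ln 2" by (subst ln_mult) auto
        also have "\<dots> \<le> 2" using ln_le_minus_one[of 2] by simp
        finally have "256 * (real d / \<epsilon>\<^sup>2) * ln (2 * real d / \<delta>) \<le> 256 * (real d / \<epsilon>\<^sup>2) * 2"
          by (intro mult_left_mono) auto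
        also have "(1 / 2)\<^sup>2 \<le> \<epsilon>\<^sup>2" using half by (intro power_mono) auto
        then have "1 / \<epsilon>\<^sup>2 \<le> 4" using \<epsilon> by (simp add: divide_le_eq power2_eq_square)
        then have "256 * (real d / \<epsilon>\<^sup>2) * 2 \<le> 2048" using d1 by simp
        also have "\<dots> \<le> real N" using False by (simp add: M_def)
        finally show ?thesis by simp
      next
        case True
        \<comment> \<open>Both \<open>\<epsilon>\<close> and \<open>\<delta>\<close> are at least
          \<open>\<epsilon> * \<delta>\<close>, so smallness of \<open>L\<close> yields both
          conditions of the one-dimensional case: \<open>1 - \<delta> \<le> (1 / 4) ^ N\<close> and
          \<open>\<epsilon> \<ge> 3 / 4\<close>.\<close>
        have "1 - \<epsilon> * \<delta> \<le> L"
          using ln_le_minus_one[of "\<epsilon> * \<delta>"] \<epsilon>\<delta> by (simp add: L_def d1 ln_div)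
        also have "L \<le> 1 / 4 ^ M"
        proof -
          have "1 \<le> 1 / \<epsilon>\<^sup>2" using \<epsilon> by (simp add: power_le_one)
          then have "L * 1 \<le> L * (1 / \<epsilon>\<^sup>2)" using L by (intro mult_left_mono) auto
          then have "C * L \<le> C * (L * (1 / \<epsilon>\<^sup>2))" using C by (intro mult_left_mono) auto
          also have "\<dots> \<le> real M" using Nge d1 True by (simp add: L_def mult.assoc mult.commute)
          finally have "real M * (4 ^ M * L) \<le> real M * 1" by (simp add: C_def mult.assoc)
          then have "4 ^ M * L \<le> 1" by (subst (asm) mult_le_cancel_left_pos) (auto simp: M_def)
          then show ?thesis by (simp add: le_divide_eq mult.commute)
        qed
        finally have small: "1 - \<epsilon> * \<delta> \<le> 1 / 4 ^ M" .
        have "(1 / 4::real) ^ M \<le> (1 / 4) ^ N" using True by (intro power_decreasing) auto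
        then have "1 - \<delta> \<le> (1 / 4) ^ N" using small \<epsilon>\<delta> by (simp add: power_one_over)
        moreover have "(1 / 4::real) ^ M \<le> (1 / 4) ^ 1" by (intro power_decreasing) (auto simp: M_def)
        then have "1 / 4 ^ M \<le> (1 / 4::real)" by (simp only: power_one_over power_one_right)
        then have "2 / 3 \<le> \<epsilon>" using small \<epsilon>\<delta> by linarith
        ultimately show ?thesis using d1 by simp
      qed
    qed
    then show "\<exists>p. (\<forall>i<n. p i \<ge> 0) \<and> (\<Sum>i<n. p i) = real N \<and>
               (\<forall>y. measure_pmf.prob (sampling_pmf n p N) (good_event n d N X y p \<epsilon>) \<ge> 1 - \<delta>)"
      by (rule lewis_sampling[OF lw d N \<epsilon> \<delta>(1)])
  qed (use C in simp)
next
  fix \<delta> :: real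
  assume \<delta>: "0 < \<delta>" "\<delta> < 1"
  \<comment> \<open>Since \<open>d \<ge> 2\<close>, the constant \<open>ln (2 / \<delta>)\<close> is
    at most \<open>ln (2 / \<delta>) / ln 2\<close> times \<open>ln (real d)\<close>, and can be
    absorbed into the factor.\<close>
  define C where "C = 256 * (1 + ln (2 / \<delta>) / ln 2)"
  have "ln (2 / \<delta>) > 0" using \<delta> by (simp add: less_divide_eq)
  then have C: "C > 0" unfolding C_def by (auto intro!: add_pos_pos divide_pos_pos)
  show "\<exists>C'>0. \<forall>n d X w \<epsilon> (N::nat).
            d \<ge> 2 \<longrightarrow> full_col_rank n d X \<longrightarrow> lewis_weights n d X w \<longrightarrow>
            0 < \<epsilon> \<longrightarrow> \<epsilon> < 1 \<longrightarrow>
            real N \<ge> C' * (1 / \<epsilon>\<^sup>2) * real d * ln (real d) \<longrightarrow>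
            (\<exists>p. (\<forall>i<n. p i \<ge> 0) \<and> (\<Sum>i<n. p i) = real N \<and>
               (\<forall>y. measure_pmf.prob (sampling_pmf n p N) (good_event n d N X y p \<epsilon>) \<ge> 1 - \<delta>))"
  proof (rule exI[of _ C], intro conjI allI impI)
    fix n d N :: nat and X :: "nat \<Rightarrow> nat \<Rightarrow> real" and w :: "nat \<Rightarrow> real" and \<epsilon> :: real
    assume d: "2 \<le> d" and lw: "lewis_weights n d X w" and \<epsilon>: "0 < \<epsilon>" "\<epsilon> < 1"
      and Nge: "C * (1 / \<epsilon>\<^sup>2) * real d * ln (real d) \<le> real N"
    have "C * (1 / \<epsilon>\<^sup>2) * real d * ln (real d) > 0" using C d \<epsilon> by simp
    then have N: "N > 0" using Nge by (cases N) auto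
    have d1: "d \<ge> 1" using d by simp
    have "ln 2 \<le> ln (real d)" using d by simp
    then have "ln (2 / \<delta>) \<le> ln (2 / \<delta>) / ln 2 * ln (real d)"
      using \<open>ln (2 / \<delta>) > 0\<close> by (simp add: field_simps)
    moreover have "ln (2 * real d / \<delta>) = ln (2 / \<delta>) + ln (real d)"
      using d \<delta> ln_mult[of "2 / \<delta>" "real d"] by simp
    ultimately have "ln (2 * real d / \<delta>) \<le> (1 + ln (2 / \<delta>) / ln 2) * ln (real d)"
      unfolding distrib_right by linarith
    then have "256 * ln (2 * real d / \<delta>) \<le> C * ln (real d)"
      unfolding C_def mult.assoc by (intro mult_left_mono) auto
    then have "(real d / \<epsilon>\<^sup>2) * (256 * ln (2 * real d / \<delta>)) \<le> (real d / \<epsilon>\<^sup>2) * (C * ln (real d))"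
      by (intro mult_left_mono) auto
    also have "\<dots> = C * (1 / \<epsilon>\<^sup>2) * real d * ln (real d)" by simp
    finally have "256 * (real d / \<epsilon>\<^sup>2) * ln (2 * real d / \<delta>) \<le> real N" using Nge by (simp add: mult_ac)
    then show "\<exists>p. (\<forall>i<n. p i \<ge> 0) \<and> (\<Sum>i<n. p i) = real N \<and>
               (\<forall>y. measure_pmf.prob (sampling_pmf n p N) (good_event n d N X y p \<epsilon>) \<ge> 1 - \<delta>)"
      using lewis_sampling[OF lw d1 N \<epsilon> \<delta>(1)] by blast
  qed (use C in simp)
qed

end
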